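(* Let $X$ be a Polish space, let $(a_n)$ be a sequence of strictly positive real numbers with $\lim_n a_n=+\infty$, let $(\mu_n)$ be a sequence in $\mathcal{P}(X)$, and let $I\colon X\to[0,+\infty]$ be lower semicontinuous. Define $H_n^{\mathbf a}\colon \mathcal P(X)\to[0,+\infty]$ by $H_n^{\mathbf a}(\nu)=\frac1{a_n}H(\nu|\mu_n)$ and $l_n^{\mathbf a}\colon \mathfrak K(X)\to[0,+\infty]$ by $l_n^{\mathbf a}(K)=-\frac1{a_n}\log\mu_n(K)$. Then the following are equivalent. (P1) $(\mu_n)$ satisfies a large deviations weak upper bound with speed $(a_n)$ and rate $I$. (P2) For each sequence $(\varphi_n)$ of measurable maps $\varphi_n\colon X\to[-\infty,+\infty]$ bounded from below (i.e. $\inf_n\inf_{x\in X}\varphi_n(x)>-\infty$) and such that $$\inf_{K\subset X\text{ compact}}\ \varlimsup_n\frac{\mu_n\big(\mathbf 1_{K^c}\exp(-a_n\varphi_n)\big)}{\mu_n\big(\exp(-a_n\varphi_n)\big)}=0,$$ the following inequality holds: $$\varlimsup_n\tfrac1{a_n}\log\mu_n\big(\exp(-a_n\varphi_n)\big)\ \le\ \sup_{x\in X}\big\{-\big(\Gamma\text{-}\varliminf_n\varphi_n\big)(x)-I(x)\big\},$$ where $-\big(\Gamma\text{-}\varliminf_n\varphi_n\big)(x)-I(x):=-\infty$ whenever $I(x)=+\infty$. (H1) For each $x\in X$, $\big(\Gamma\text{-}\varliminf_nH_n^{\mathbf a}\big)(\delta_x)\ge I(x)$, where $\delta_x$ is the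 Dirac mass at $x$. (H2) For each $\nu\in\mathcal P(X)$, $\big(\Gamma\text{-}\varliminf_nH_n^{\mathbf a}\big)(\nu)\ge\nu(I)$. (L) $\Gamma\text{-}\varliminf_nl_n^{\mathbf a}\ge l_I$ on $\mathfrak K(X)$, where $l_I(K)=\inf_{x\in K}I(x)$. Assume furthermore that $(\mu_n)$ is exponentially tight with speed $(a_n)$. Then the statements (P1), (P2), (H1), (H2) and (L) are also equivalent to (P3) $(\mu_n)$ satisfies a large deviations upper bound with speed $(a_n)$ and rate $I$. (P4) For each sequence $(\varphi_n)$ of measurable maps $\varphi_n\colon X\to[-\infty,+\infty]$ bounded from below (i.e. $\inf_n\inf_{x\in X}\varphi_n(x)>-\infty$) it holds $$\varlimsup_n\tfrac1{a_n}\log\mu_n\big(\exp(-a_n\varphi_n)\big)\ \le\ \sup_{x\in X}\big\{-\big(\Gamma\text{-}\varliminf_n\varphi_n\big)(x)-I(x)\big\},$$ where $-\big(\Gamma\text{-}\varliminf_n\varphi_n\big)(x)-I(x):=-\infty$ whenever $I(x)=+\infty$.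
   Context: $\mathcal P(X)$ is the space of Borel probability measures on $X$ with the narrow (weak) topology; $\mu(f)$ denotes the integral of $f$ with respect to $\mu$. $\mathfrak K(X)$ is the collection of compact subsets of $X$ with the Hausdorff topology, i.e. the topology of the distance $d_H(K,K')=\inf\{\varepsilon>0: K\subset K'^{\varepsilon},\ K'\subset K^{\varepsilon}\}$, where $A^\varepsilon$ is the $\varepsilon$-enlargement of $A$ for a fixed compatible distance on $X$. The relative entropy is $H(\nu|\mu)=\sup_\varphi\{\nu(\varphi)-\log\mu(e^\varphi)\}$, the supremum being over bounded Borel functions $\varphi$ on $X$. Convention: $-\log0=+\infty$. $(\mu_n)$ satisfies, with speed $(a_n)$ and rate $I$: a large deviations weak upper bound iff $\varlimsup_n\frac1{a_n}\log\mu_n(K)\le-\inf_{x\in K}I(x)$ for each compact $K\subset X$; a large deviations upper bound iff $\varlimsup_n\frac1{a_n}\log\mu_n(C)\le-\inf_{x\in C}I(x)$ for each closed $C\subset X$. $(\mu_n)$ is exponentially tight with speed $(a_n)$ iff $\inf_{K\subset X\text{ compact}}\varlimsup_n\frac1{a_n}\log\mu_n(K^c)=-\infty$. For a sequence of functions $F_n\colon Z\to[-\infty,+\infty]$ on a Polish space $Z$ and $z\in Z$: $\big(\Gamma\text{-}\varliminf_nF_n\big)(z)=\inf\{\varliminf_nF_n(z_n): (z_n)\text{ a sequence in }Z,\ z_n\to z\}$. *)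

theory Defs
  imports "HOL-Probability.Probability"
begin

definition borel_probs :: "'a::topological_space measure set" where
  "borel_probs = {\<nu>. prob_space \<nu> \<and> sets \<nu> = sets borel}"

text \<open>The narrow topology is the coarsest topology on the Borel probability measures for which
  \<open>\<nu> \<mapsto> \<nu>(f)\<close> is continuous for every bounded continuous \<open>f\<close>.\<close>

definition narrow_topology :: "'a::topological_space measure topology" where
  "narrow_topology = topology_generated_by
     {{\<nu> \<in> borel_probs. (\<integral>x. f x \<partial>\<nu>) \<in> U} | (f :: 'a \<Rightarrow> real) U.
        continuous_on UNIV f \<and> bounded (range f) \<and> open U}"

definition enlargement :: "('a \<Rightarrow> 'a \<Rightarrow> real) \<Rightarrow> 'a set \<Rightarrow> real \<Rightarrow> 'a set" where
  "enlargement d A \<epsilon> = {x. \<exists>y\<in>A. d x y < \<epsilon>}"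

text \<open>The value is \<open>\<infinity>\<close>, the infimum of the empty set, when exactly one of the two sets is empty;
  the empty set is thus an isolated point of the space of compact sets.\<close>

definition hausdorff_dist :: "('a \<Rightarrow> 'a \<Rightarrow> real) \<Rightarrow> 'a set \<Rightarrow> 'a set \<Rightarrow> ereal" where
  "hausdorff_dist d K K' =
     Inf {ereal \<epsilon> | \<epsilon>. \<epsilon> > 0 \<and> K \<subseteq> enlargement d K' \<epsilon> \<and> K' \<subseteq> enlargement d K \<epsilon>}"

definition hausdorff_ball ::
    "('a::topological_space \<Rightarrow> 'a \<Rightarrow> real) \<Rightarrow> 'a set \<Rightarrow> real \<Rightarrow> 'a set set" where
  "hausdorff_ball d K \<epsilon> = {K'. compact K' \<and> hausdorff_dist d K K' < ereal \<epsilon>}"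

definition hausdorff_topology ::
    "('a::topological_space \<Rightarrow> 'a \<Rightarrow> real) \<Rightarrow> 'a set topology" where
  "hausdorff_topology d =
     topology (\<lambda>U. U \<subseteq> Collect compact \<and> (\<forall>K\<in>U. \<exists>\<epsilon>>0. hausdorff_ball d K \<epsilon> \<subseteq> U))"

lemma openin_hausdorff_topology:
  "openin (hausdorff_topology d) U \<longleftrightarrow>
     U \<subseteq> Collect compact \<and> (\<forall>K\<in>U. \<exists>\<epsilon>>0. hausdorff_ball d K \<epsilon> \<subseteq> U)"
proof -
  define P where
    "P = (\<lambda>U. U \<subseteq> Collect compact \<and> (\<forall>K\<in>U. \<exists>\<epsilon>>0. hausdorff_ball d K \<epsilon> \<subseteq> U))"
  have mono: "hausdorff_ball d K e \<subseteq> hausdorff_ball d K f" if "e \<le> f" for K e f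
    unfolding hausdorff_ball_def using that less_le_trans[of _ "ereal e" "ereal f"] by auto
  have "P (S \<inter> T)" if "P S" "P T" for S T
    unfolding P_def
  proof (intro conjI ballI)
    show "S \<inter> T \<subseteq> Collect compact" using that by (auto simp: P_def)
    fix K assume "K \<in> S \<inter> T"
    then obtain e f where "e > 0" "hausdorff_ball d K e \<subseteq> S" "f > 0" "hausdorff_ball d K f \<subseteq> T"
      using \<open>P S\<close> \<open>P T\<close> unfolding P_def by blast
    then have "min e f > 0" "hausdorff_ball d K (min e f) \<subseteq> S \<inter> T"
      using mono[of "min e f" e K] mono[of "min e f" f K] by auto
    then show "\<exists>\<epsilon>>0. hausdorff_ball d K \<epsilon> \<subseteq> S \<inter> T" by blast
  qed
  moreover have "P (\<Union>\<K>)" if *: "\<forall>S\<in>\<K>. P S" for \<K>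
    unfolding P_def
  proof (intro conjI ballI)
    show "\<Union>\<K> \<subseteq> Collect compact" using * by (auto simp: P_def)
    fix K assume "K \<in> \<Union>\<K>"
    then obtain S where "S \<in> \<K>" "K \<in> S" by auto
    moreover from this * obtain e where "e > 0" "hausdorff_ball d K e \<subseteq> S"
      unfolding P_def by blast
    ultimately show "\<exists>\<epsilon>>0. hausdorff_ball d K \<epsilon> \<subseteq> \<Union>\<K>" by blast
  qed
  ultimately have "istopology P" by (simp add: istopology_def)
  then have "openin (topology P) = P" by (rule topology_inverse')
  then show ?thesis by (simp add: hausdorff_topology_def P_def)
qed

lemma topspace_hausdorff_topology: "topspace (hausdorff_topology d) = Collect compact"
proof
  show "topspace (hausdorff_topology d) \<subseteq> Collect compact"
    using openin_topspace[of "hausdorff_topology d"] unfolding openin_hausdorff_topology by simp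
  have "hausdorff_ball d K 1 \<subseteq> Collect compact" for K
    by (auto simp: hausdorff_ball_def)
  then have "openin (hausdorff_topology d) (Collect compact)"
    unfolding openin_hausdorff_topology using zero_less_one by blast
  then show "Collect compact \<subseteq> topspace (hausdorff_topology d)"
    by (rule openin_subset)
qed

definition Gamma_liminf :: "'z topology \<Rightarrow> (nat \<Rightarrow> 'z \<Rightarrow> ereal) \<Rightarrow> 'z \<Rightarrow> ereal" where
  "Gamma_liminf Z F z =
     (INF s \<in> {s. range s \<subseteq> topspace Z \<and> limitin Z s z sequentially}. liminf (\<lambda>n. F n (s n)))"

definition lower_semicontinuous :: "('a::topological_space \<Rightarrow> ennreal) \<Rightarrow> bool" where
  "lower_semicontinuous I \<longleftrightarrow> (\<forall>t. open {x. t < I x})"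

definition ln_ennreal :: "ennreal \<Rightarrow> ereal" where
  "ln_ennreal u = (if u = 0 then -\<infinity> else if u = \<infinity> then \<infinity> else ereal (ln (enn2real u)))"

definition exp_ereal :: "ereal \<Rightarrow> ennreal" where
  "exp_ereal t = (case t of ereal r \<Rightarrow> ennreal (exp r) | PInfty \<Rightarrow> \<infinity> | MInfty \<Rightarrow> 0)"

definition rel_entropy :: "'a::topological_space measure \<Rightarrow> 'a measure \<Rightarrow> ereal" where
  "rel_entropy \<nu> \<mu> =
     (SUP \<phi> \<in> {\<phi> :: 'a \<Rightarrow> real. \<phi> \<in> borel_measurable borel \<and> bounded (range \<phi>)}.
        ereal ((\<integral>x. \<phi> x \<partial>\<nu>) - ln (\<integral>x. exp (\<phi> x) \<partial>\<mu>)))"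

definition scaled_entropy ::
    "(nat \<Rightarrow> 'a::topological_space measure) \<Rightarrow> (nat \<Rightarrow> real) \<Rightarrow> nat \<Rightarrow> 'a measure \<Rightarrow> ereal" where
  "scaled_entropy \<mu> a n \<nu> = ereal (1 / a n) * rel_entropy \<nu> (\<mu> n)"

definition neg_log_mass ::
    "(nat \<Rightarrow> 'a::topological_space measure) \<Rightarrow> (nat \<Rightarrow> real) \<Rightarrow> nat \<Rightarrow> 'a set \<Rightarrow> ereal" where
  "neg_log_mass \<mu> a n K = - (ereal (1 / a n) * ln_ennreal (emeasure (\<mu> n) K))"

definition ld_weak_upper_bound ::
    "(nat \<Rightarrow> 'a::topological_space measure) \<Rightarrow> (nat \<Rightarrow> real) \<Rightarrow> ('a \<Rightarrow> ennreal) \<Rightarrow> bool" where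
  "ld_weak_upper_bound \<mu> a I \<longleftrightarrow>
     (\<forall>K. compact K \<longrightarrow>
        limsup (\<lambda>n. ereal (1 / a n) * ln_ennreal (emeasure (\<mu> n) K)) \<le> - (INF x\<in>K. enn2ereal (I x)))"

definition ld_upper_bound ::
    "(nat \<Rightarrow> 'a::topological_space measure) \<Rightarrow> (nat \<Rightarrow> real) \<Rightarrow> ('a \<Rightarrow> ennreal) \<Rightarrow> bool" where
  "ld_upper_bound \<mu> a I \<longleftrightarrow>
     (\<forall>C. closed C \<longrightarrow>
        limsup (\<lambda>n. ereal (1 / a n) * ln_ennreal (emeasure (\<mu> n) C)) \<le> - (INF x\<in>C. enn2ereal (I x)))"

definition exponentially_tight ::
    "(nat \<Rightarrow> 'a::topological_space measure) \<Rightarrow> (nat \<Rightarrow> real) \<Rightarrow> bool" where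
  "exponentially_tight \<mu> a \<longleftrightarrow>
     (INF K \<in> Collect compact. limsup (\<lambda>n. ereal (1 / a n) * ln_ennreal (emeasure (\<mu> n) (- K)))) = -\<infinity>"

definition measurable_bounded_below :: "(nat \<Rightarrow> 'a::topological_space \<Rightarrow> ereal) \<Rightarrow> bool" where
  "measurable_bounded_below \<phi> \<longleftrightarrow>
     (\<forall>n. \<phi> n \<in> borel_measurable borel) \<and> (INF n. INF x. \<phi> n x) > -\<infinity>"

text \<open>The quotient is \<open>0\<close> when its denominator vanishes, since \<open>0 / 0 = 0\<close> in \<^typ>\<open>ennreal\<close>.
  Such indices \<open>n\<close> contribute \<open>-\<infinity>\<close> to the upper limit in \<open>laplace_upper_bound\<close>.\<close>

definition asymptotically_tight_weights ::
    "(nat \<Rightarrow> 'a::topological_space measure) \<Rightarrow> (nat \<Rightarrow> real) \<Rightarrow> (nat \<Rightarrow> 'a \<Rightarrow> ereal) \<Rightarrow> bool" where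
  "asymptotically_tight_weights \<mu> a \<phi> \<longleftrightarrow>
     (INF K \<in> Collect compact. limsup (\<lambda>n.
        (\<integral>\<^sup>+x. indicator (- K) x * exp_ereal (- (ereal (a n) * \<phi> n x)) \<partial>\<mu> n) /
        (\<integral>\<^sup>+x. exp_ereal (- (ereal (a n) * \<phi> n x)) \<partial>\<mu> n))) = 0"

definition laplace_upper_bound ::
    "(nat \<Rightarrow> 'a::topological_space measure) \<Rightarrow> (nat \<Rightarrow> real) \<Rightarrow> ('a \<Rightarrow> ennreal) \<Rightarrow>
     (nat \<Rightarrow> 'a \<Rightarrow> ereal) \<Rightarrow> bool" where
  "laplace_upper_bound \<mu> a I \<phi> \<longleftrightarrow>
     limsup (\<lambda>n. ereal (1 / a n) *
       ln_ennreal (\<integral>\<^sup>+x. exp_ereal (- (ereal (a n) * \<phi> n x)) \<partial>\<mu> n))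
     \<le> (SUP x. if I x = \<infinity> then -\<infinity> else - Gamma_liminf euclidean \<phi> x - enn2ereal (I x))"

end

theory Submission
  imports Defs
begin

text \<open>
  Every statement of the theorem is equivalent to one local condition, \<open>local_decay\<close> below: whenever
  \<open>t < I x\<close>, some open neighbourhood \<open>U\<close> of \<open>x\<close> has \<open>\<mu>\<^sub>n(U) \<le> exp (- a\<^sub>n t)\<close> for all large \<open>n\<close>. For
  (P3) and (P4) this uses exponential tightness.

  That the weak upper bound, a statement about compact sets only, controls neighbourhoods of points
  is the surprising step, since \<open>X\<close> need not be locally compact. If the condition failed at \<open>x\<close>,
  then balls shrinking to \<open>x\<close> would be too heavy along a subsequence; inner regularity replaces each
  of them by a compact subset, and these compact sets together with \<open>x\<close> form a single compact set,
  near \<open>x\<close>, that contradicts the weak upper bound (\<open>ld_weak_upper_bound_imp_local_decay\<close>).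

  Conversely, local decay passes from points to neighbourhoods of compact sets by finite
  subcovers, because a finite sum of exponentials is governed by its largest term
  (\<open>compact_subadditive_decay\<close>). Applied to \<open>\<mu>\<^sub>n\<close> itself this yields the bound (L), since a sequence of
  compact sets converging to \<open>K\<close> in the Hausdorff topology is eventually inside every
  neighbourhood of \<open>K\<close>. Applied to the weighted measures \<open>exp (- a\<^sub>n \<phi>\<^sub>n) \<mu>\<^sub>n\<close> it yields a Laplace bound near
  each compact set (\<open>local_decay_laplace_near_compact\<close>); tightness of the weights for (P2) and exponential tightness for (P4)
  make the part of the integral away from a compact set harmless. Taking \<open>\<phi>\<^sub>n = 0\<close> on a
  closed set and \<open>\<infinity>\<close> elsewhere turns the Laplace bounds back into upper bounds for that set.

  For (H2), the lower semicontinuous \<open>I\<close> is the supremum of an increasing sequence of bounded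
  continuous functions \<open>f\<close>. Cutting \<open>f\<close> off outside a neighbourhood of a compact set that carries most
  of \<open>\<nu>\<close> gives a continuous test function \<open>\<psi>\<close>; the Laplace bound makes \<open>\<mu>\<^sub>n(exp (a\<^sub>n \<psi>))\<close>
  grow at an arbitrarily small exponential rate, and the variational formula bounds the scaled
  entropy from below by nearly \<open>\<nu>(f)\<close>. Since the Laplace bound holds on an open set, the compact set
  is chosen from the tightness of the single measure \<open>\<nu>\<close>, and the measures converging to \<open>\<nu>\<close> enter
  only through their integrals of \<open>\<psi>\<close>.
  (H1) is (H2) at Dirac masses. Finally (H1) gives back local decay: conditioning \<open>\<mu>\<^sub>n\<close> on a small ball
  \<open>B\<close> around \<open>x\<close> gives measures close to the Dirac mass at \<open>x\<close> whose entropy is at most \<open>- ln \<mu>\<^sub>n(B)\<close>.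
\<close>

section \<open>Exponential bounds\<close>

lemma scaled_ln_le_iff:
  assumes "a > 0"
  shows "ereal (1 / a) * ln_ennreal u \<le> ereal t \<longleftrightarrow> u \<le> ennreal (exp (a * t))"
proof (cases u)
  case (real r)
  show ?thesis
  proof (cases "r = 0")
    case True
    then show ?thesis using real assms by (simp add: ln_ennreal_def)
  next
    case False
    with real have "r > 0" by simp
    then have "ln r / a \<le> t \<longleftrightarrow> r \<le> exp (a * t)"
      using assms by (metis exp_le_cancel_iff exp_ln mult.commute pos_divide_le_eq)
    then show ?thesis using real \<open>r > 0\<close> by (simp add: ln_ennreal_def)
  qed
next
  case top
  have "\<not> top \<le> ennreal (exp (a * t))" by (simp add: top_unique)
  with top show ?thesis using assms by (simp add: ln_ennreal_def)
qed

text \<open>Restates the logarithmic upper limits in all the definitions as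
  eventual bounds by exponentials; sums, products and integrals are estimated in that form.\<close>

lemma limsup_scaled_ln_le_iff:
  assumes "\<And>n. a n > 0"
  shows "limsup (\<lambda>n. ereal (1 / a n) * ln_ennreal (u n)) \<le> L \<longleftrightarrow>
    (\<forall>t. L < ereal t \<longrightarrow> (\<forall>\<^sub>F n in sequentially. u n \<le> ennreal (exp (a n * t))))"
    (is "?lhs \<longleftrightarrow> ?rhs")
proof
  assume ?lhs
  show ?rhs
  proof (intro allI impI)
    fix t assume "L < ereal t"
    with \<open>?lhs\<close> have "\<forall>\<^sub>F n in sequentially. ereal (1 / a n) * ln_ennreal (u n) < ereal t"
      unfolding Limsup_le_iff by blast
    then show "\<forall>\<^sub>F n in sequentially. u n \<le> ennreal (exp (a n * t))"
      by eventually_elim (simp add: scaled_ln_le_iff[OF assms, symmetric])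
  qed
next
  assume r: ?rhs
  show ?lhs unfolding Limsup_le_iff
  proof (intro allI impI)
    fix y assume "L < y"
    then obtain t where t: "L < ereal t" "ereal t < y" using ereal_dense2 by blast
    from r t(1) have "\<forall>\<^sub>F n in sequentially. u n \<le> ennreal (exp (a n * t))" by blast
    then show "\<forall>\<^sub>F n in sequentially. ereal (1 / a n) * ln_ennreal (u n) < y"
      by eventually_elim (use t(2) scaled_ln_le_iff[OF assms] in \<open>metis order_le_less_trans\<close>)
  qed
qed

text \<open>Since \<open>a\<close> diverges, a constant factor is absorbed by an arbitrarily small loss in the exponent.\<close>

lemma eventually_mult_exp_le:
  assumes "filterlim a at_top sequentially" "t < t'"
  shows "\<forall>\<^sub>F n in sequentially. c * exp (a n * t) \<le> exp (a n * t' :: real)"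
proof -
  \<comment> \<open>the maximum with 1 keeps the logarithm meaningful for every \<open>c\<close>\<close>
  have "\<forall>\<^sub>F n in sequentially. a n \<ge> ln (max c 1) / (t' - t)"
    using assms(1) by (simp add: filterlim_at_top)
  then show ?thesis
  proof eventually_elim
    case (elim n)
    then have "ln (max c 1) \<le> a n * t' - a n * t"
      using assms(2) by (simp add: pos_divide_le_eq algebra_simps)
    then have "max c 1 \<le> exp (a n * t' - a n * t)"
      by (metis exp_ln exp_le_cancel_iff less_max_iff_disj zero_less_one)
    then have "max c 1 * exp (a n * t) \<le> exp (a n * t')"
      by (simp add: exp_diff le_divide_eq)
    moreover have "c * exp (a n * t) \<le> max c 1 * exp (a n * t)"
      by (intro mult_right_mono) auto
    ultimately show ?case by linarith
  qed
qed

text \<open>A finite subcover turns bounds at points into a bound near \<open>K\<close>: the number of covering sets is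
  a constant factor, hence invisible on the exponential scale. The set functions \<open>m n\<close> will be the
  measures \<open>\<mu> n\<close> and the measures with density \<open>exp (- a\<^sub>n \<phi>\<^sub>n)\<close> with respect to \<open>\<mu> n\<close>.\<close>

lemma compact_subadditive_decay:
  fixes m :: "nat \<Rightarrow> 'a::topological_space set \<Rightarrow> ennreal"
  assumes a: "filterlim a at_top sequentially" and K: "compact K"
    and empty: "\<And>n. m n {} = 0"
    and subadd: "\<And>n U V. open U \<Longrightarrow> open V \<Longrightarrow> m n (U \<union> V) \<le> m n U + m n V"
    and loc: "\<And>x. x \<in> K \<Longrightarrow> \<exists>U. open U \<and> x \<in> U \<and>
      (\<forall>\<^sub>F n in sequentially. m n U \<le> ennreal (exp (a n * t)))"
    and "t < t'"
  obtains U where "open U" "K \<subseteq> U" "\<forall>\<^sub>F n in sequentially. m n U \<le> ennreal (exp (a n * t'))"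
proof -
  let ?\<U> = "{U. open U \<and> (\<forall>\<^sub>F n in sequentially. m n U \<le> ennreal (exp (a n * t)))}"
  have "K \<subseteq> \<Union>?\<U>" using loc by blast
  then obtain \<F> where \<F>: "\<F> \<subseteq> ?\<U>" "finite \<F>" "K \<subseteq> \<Union>\<F>"
    using compactE[OF K, of ?\<U>] by blast
  have "open (\<Union>\<F>) \<and>
    (\<forall>\<^sub>F n in sequentially. m n (\<Union>\<F>) \<le> ennreal (real (card \<F>) * exp (a n * t)))"
    using \<F>(2,1)
  proof (induction \<F> rule: finite_induct)
    case empty
    then show ?case by (simp add: assms(3))
  next
    case (insert U \<F>)
    then have U: "open U" "\<forall>\<^sub>F n in sequentially. m n U \<le> ennreal (exp (a n * t))"
      and \<F>: "open (\<Union>\<F>)"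
        "\<forall>\<^sub>F n in sequentially. m n (\<Union>\<F>) \<le> ennreal (real (card \<F>) * exp (a n * t))" by auto
    from U(2) \<F>(2) have
      "\<forall>\<^sub>F n in sequentially. m n (U \<union> \<Union>\<F>) \<le> ennreal (real (card (insert U \<F>)) * exp (a n * t))"
    proof eventually_elim
      case (elim n)
      have "m n (U \<union> \<Union>\<F>) \<le> m n U + m n (\<Union>\<F>)" by (rule subadd[OF U(1) \<F>(1)])
      also have "\<dots> \<le> ennreal (exp (a n * t)) + ennreal (real (card \<F>) * exp (a n * t))"
        using elim by (rule add_mono)
      also have "\<dots> = ennreal (real (card (insert U \<F>)) * exp (a n * t))"
        using insert by (simp add: algebra_simps flip: ennreal_plus)
      finally show ?case .
    qed
    then show ?case using U(1) \<F>(1) by auto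
  qed
  then have "open (\<Union>\<F>)"
    and bound: "\<forall>\<^sub>F n in sequentially. m n (\<Union>\<F>) \<le> ennreal (real (card \<F>) * exp (a n * t))"
    by auto
  from bound eventually_mult_exp_le[OF a \<open>t < t'\<close>, of "real (card \<F>)"]
  have "\<forall>\<^sub>F n in sequentially. m n (\<Union>\<F>) \<le> ennreal (exp (a n * t'))"
    by eventually_elim (meson ennreal_leI order_trans)
  with that \<F>(3) \<open>open (\<Union>\<F>)\<close> show thesis by blast
qed

section \<open>Sequential \<open>\<Gamma>\<close>-lower limits\<close>

text \<open>If elements with property \<open>P\<close> occur for infinitely many \<open>n\<close> in each of the sets \<open>V k\<close>, which
  shrink around \<open>z\<close>, then choosing them along a subsequence and taking \<open>z\<close> at all other
  indices gives one full sequence that converges to \<open>z\<close> and has \<open>P\<close> infinitely often.\<close>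

lemma diagonal_selection:
  fixes V :: "nat \<Rightarrow> 'z set" and P :: "nat \<Rightarrow> 'z \<Rightarrow> bool"
  assumes V: "decseq V" and z: "\<And>k. z \<in> V k"
    and freq: "\<And>k. \<exists>\<^sub>F n in sequentially. \<exists>w\<in>V k. P n w"
  shows "\<exists>s. (\<forall>n. s n \<in> V 0) \<and> (\<forall>k. \<forall>\<^sub>F n in sequentially. s n \<in> V k) \<and>
    (\<exists>\<^sub>F n in sequentially. P n (s n))"
proof -
  have step: "\<exists>n>m. \<exists>w\<in>V k. P n w" for k m
    using freq[of k] unfolding frequently_sequentially by (meson Suc_le_eq)
  have "\<exists>r. \<forall>k. (\<exists>w\<in>V k. P (r k) w) \<and> r k < r (Suc k)"
    by (rule dependent_nat_choice) (use step in blast)+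
  then obtain r where r: "\<And>k. \<exists>w\<in>V k. P (r k) w" "\<And>k. r k < r (Suc k)" by blast
  then have mono: "strict_mono r" by (simp add: strict_mono_Suc_iff)
  from r(1) obtain w where w: "\<And>k. w k \<in> V k" "\<And>k. P (r k) (w k)" by metis
  define s where "s n = (if n \<in> range r then w (inv r n) else z)" for n
  have sr: "s (r k) = w k" for k
    using mono by (simp add: s_def strict_mono_imp_inj_on)
  have sV: "s n \<in> V k" if "n \<ge> r k" for n k
  proof (cases "n \<in> range r")
    case True
    then obtain j where "n = r j" by blast
    then have "k \<le> j" using that mono strict_mono_less_eq by blast
    then show ?thesis using w(1)[of j] decseqD[OF V] sr \<open>n = r j\<close> by auto
  qed (use z in \<open>simp add: s_def\<close>)
  show ?thesis
  proof (intro exI[of _ s] conjI allI)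
    show "s n \<in> V 0" for n
      using w(1) decseqD[OF V, of 0] z by (auto simp: s_def)
    show "\<forall>\<^sub>F n in sequentially. s n \<in> V k" for k
      using sV unfolding eventually_sequentially by blast
    show "\<exists>\<^sub>F n in sequentially. P n (s n)"
      unfolding frequently_sequentially using sr w(2) seq_suble[OF mono] by metis
  qed
qed

text \<open>The \<open>\<Gamma>\<close>-lower limit is defined by sequences. Around a point at which sequences that eventually
  enter each \<open>V k\<close> converge, it behaves like the neighbourhood version
  \<open>sup\<^sub>k liminf\<^sub>n inf (F\<^sub>n on V\<^sub>k)\<close>: otherwise a diagonal sequence would stay below \<open>t\<close>. In the
  narrow topology the \<open>V k\<close> will be the sets of measures carried by small balls around a point;
  these are not neighbourhoods of the Dirac mass, but convergence along them is easy to check.\<close>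

lemma Gamma_liminf_gt_imp_locally_gt:
  assumes V: "decseq V" "V 0 \<subseteq> topspace Z" "\<And>k. z \<in> V k"
    and conv: "\<And>s. range s \<subseteq> topspace Z \<Longrightarrow> (\<And>k. \<forall>\<^sub>F n in sequentially. s n \<in> V k) \<Longrightarrow>
      limitin Z s z sequentially"
    and gt: "t < Gamma_liminf Z F z"
  shows "\<exists>k. \<forall>\<^sub>F n in sequentially. \<forall>w\<in>V k. t < F n w"
proof -
  have "\<exists>k. \<not> (\<exists>\<^sub>F n in sequentially. \<exists>w\<in>V k. F n w \<le> t)"
  proof (rule ccontr)
    assume "\<not> ?thesis"
    then have *: "\<exists>\<^sub>F n in sequentially. \<exists>w\<in>V k. F n w \<le> t" for k by blast
    obtain s where s: "\<And>n. s n \<in> V 0" "\<And>k. \<forall>\<^sub>F n in sequentially. s n \<in> V k"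
      "\<exists>\<^sub>F n in sequentially. F n (s n) \<le> t"
      using diagonal_selection[OF V(1,3) *] by blast
    then have "range s \<subseteq> topspace Z" using V(2) by auto
    then have "Gamma_liminf Z F z \<le> liminf (\<lambda>n. F n (s n))"
      unfolding Gamma_liminf_def using conv s(2) by (intro INF_lower) auto
    with gt have "\<forall>\<^sub>F n in sequentially. t < F n (s n)"
      by (auto intro: less_LiminfD)
    with s(3) have "\<exists>\<^sub>F n in sequentially. F n (s n) \<le> t \<and> t < F n (s n)"
      by (rule frequently_eventually_frequently)
    then show False using frequently_ex leD by blast
  qed
  then show ?thesis by (simp add: not_frequently not_le)
qed

lemma Gamma_liminf_euclidean_gt_imp_locally_gt:
  fixes x :: "'a::metric_space"
  assumes "t < Gamma_liminf euclidean F x"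
  obtains U where "open U" "x \<in> U" "\<forall>\<^sub>F n in sequentially. \<forall>y\<in>U. t < F n y"
proof -
  have dec: "decseq (\<lambda>k. ball x (inverse (Suc k)))"
    by (intro decseq_SucI subset_ball) (simp add: field_simps)
  have "\<exists>k. \<forall>\<^sub>F n in sequentially. \<forall>y\<in>ball x (inverse (Suc k)). t < F n y"
  proof (rule Gamma_liminf_gt_imp_locally_gt[OF dec _ _ _ assms])
    fix s :: "nat \<Rightarrow> 'a"
    assume s: "\<forall>\<^sub>F n in sequentially. s n \<in> ball x (inverse (Suc k))" for k
    have "\<forall>\<^sub>F n in sequentially. dist (s n) x < e" if e: "e > 0" for e
    proof -
      obtain k where "inverse (real (Suc k)) < e" using reals_Archimedean[OF e] by auto
      with s[of k] show ?thesis by (auto simp: dist_commute elim: eventually_mono)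
    qed
    then show "limitin euclidean s x sequentially" by (simp add: tendsto_iff)
  qed auto
  then obtain k where "\<forall>\<^sub>F n in sequentially. \<forall>y\<in>ball x (inverse (Suc k)). t < F n y" ..
  then show thesis by (intro that[of "ball x (inverse (Suc k))"]) auto
qed

lemma Gamma_liminf_geI:
  assumes "\<And>s. range s \<subseteq> topspace Z \<Longrightarrow> limitin Z s z sequentially \<Longrightarrow>
    b \<le> liminf (\<lambda>n. F n (s n))"
  shows "b \<le> Gamma_liminf Z F z"
  unfolding Gamma_liminf_def using assms by (intro INF_greatest) auto

lemma borel_probsD:
  assumes "\<nu> \<in> borel_probs"
  shows "prob_space \<nu>" "sets \<nu> = sets borel" "space \<nu> = UNIV"
  using assms sets_eq_imp_space_eq[of \<nu> borel] by (auto simp: borel_probs_def)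

section \<open>Local exponential decay\<close>

definition local_decay ::
    "(nat \<Rightarrow> 'a::topological_space measure) \<Rightarrow> (nat \<Rightarrow> real) \<Rightarrow> ('a \<Rightarrow> ennreal) \<Rightarrow> bool" where
  "local_decay \<mu> a I \<longleftrightarrow> (\<forall>x t. ereal t < enn2ereal (I x) \<longrightarrow>
     (\<exists>U. open U \<and> x \<in> U \<and>
       (\<forall>\<^sub>F n in sequentially. emeasure (\<mu> n) U \<le> ennreal (exp (- (a n * t))))))"

lemma open_superlevel_lower_semicontinuous:
  assumes "lower_semicontinuous I"
  shows "open {x. ereal t < enn2ereal (I x)}"
proof (cases "t < 0")
  case True
  then have "ereal t < enn2ereal (I x)" for x
    by (intro order_less_le_trans[OF _ enn2ereal_nonneg]) simp
  then show ?thesis by simp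
next
  case False
  then have "ereal t < enn2ereal (I x) \<longleftrightarrow> ennreal t < I x" for x
    by (simp add: less_ennreal.rep_eq enn2ereal_ennreal)
  with assms show ?thesis by (simp add: lower_semicontinuous_def)
qed

text \<open>The sets that cover \<open>K\<close> also cover all but finitely many of the \<open>C n\<close>.\<close>

lemma compact_Un_converging_compacts:
  assumes K: "compact K" and C: "\<And>n. compact (C n)"
    and conv: "\<And>U. open U \<Longrightarrow> K \<subseteq> U \<Longrightarrow> \<forall>\<^sub>F n in sequentially. C n \<subseteq> U"
  shows "compact (K \<union> (\<Union>n. C n))"
  unfolding compact_eq_Heine_Borel
proof (intro allI impI, elim conjE)
  fix \<U> assume \<U>: "\<forall>U\<in>\<U>. open U" and cover: "K \<union> (\<Union>n. C n) \<subseteq> \<Union>\<U>"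
  obtain \<F> where \<F>: "\<F> \<subseteq> \<U>" "finite \<F>" "K \<subseteq> \<Union>\<F>"
    by (rule compactE[OF K, of \<U>]) (use cover \<U> in auto)
  have "open (\<Union>\<F>)" using \<F>(1) \<U> by blast
  from conv[OF this \<F>(3)] obtain N where N: "\<And>n. n \<ge> N \<Longrightarrow> C n \<subseteq> \<Union>\<F>"
    unfolding eventually_sequentially by blast
  have "compact (\<Union>n<N. C n)" using C by (intro compact_UN) auto
  then obtain \<G> where \<G>: "\<G> \<subseteq> \<U>" "finite \<G>" "(\<Union>n<N. C n) \<subseteq> \<Union>\<G>"
    by (rule compactE[of "\<Union>n<N. C n" \<U>]) (use cover \<U> in blast)+
  have "C n \<subseteq> \<Union>(\<F> \<union> \<G>)" for n
    using N[of n] \<G>(3) by (cases "n < N") auto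
  then have "K \<union> (\<Union>n. C n) \<subseteq> \<Union>(\<F> \<union> \<G>)" using \<F>(3) by blast
  then show "\<exists>\<U>'\<subseteq>\<U>. finite \<U>' \<and> K \<union> (\<Union>n. C n) \<subseteq> \<Union>\<U>'"
    using \<F> \<G> by (intro exI[of _ "\<F> \<union> \<G>"]) auto
qed

text \<open>The decay at \<open>x\<close> is proved by contradiction. Balls that are too heavy contain compact sets that
  are too heavy, and the union of \<open>x\<close> with compact sets shrinking to \<open>x\<close> is again compact. All of
  this takes place inside the open set \<open>G\<close> on which \<open>I > t'\<close>, where the weak upper bound
  forces decay faster than \<open>exp (- a\<^sub>n t)\<close>.\<close>

lemma ld_weak_upper_bound_imp_local_decay:
  fixes \<mu> :: "nat \<Rightarrow> 'a::polish_space measure"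
  assumes a: "\<And>n. a n > 0" and \<mu>: "\<And>n. \<mu> n \<in> borel_probs" and I: "lower_semicontinuous I"
    and P1: "ld_weak_upper_bound \<mu> a I"
  shows "local_decay \<mu> a I"
  unfolding local_decay_def
proof (intro allI impI, rule ccontr)
  fix x t assume t: "ereal t < enn2ereal (I x)"
  assume contra: "\<not> (\<exists>U. open U \<and> x \<in> U \<and>
    (\<forall>\<^sub>F n in sequentially. emeasure (\<mu> n) U \<le> ennreal (exp (- (a n * t)))))"
  obtain t' where t': "ereal t < ereal t'" "ereal t' < enn2ereal (I x)"
    using ereal_dense2[OF t] by blast
  define G where "G = {y. ereal t' < enn2ereal (I y)}"
  have G: "open G" "x \<in> G"
    using open_superlevel_lower_semicontinuous[OF I] t'(2) by (auto simp: G_def)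
  define V where "V k = {C. compact C \<and> C \<subseteq> ball x (inverse (Suc k)) \<inter> G}" for k
  let ?P = "\<lambda>n C. ennreal (exp (- (a n * t))) < emeasure (\<mu> n) C"
  have "ball x (inverse (Suc (Suc k))) \<subseteq> ball x (inverse (Suc k))" for k
    by (intro subset_ball) (simp add: field_simps)
  then have dec: "decseq V" unfolding V_def by (intro decseq_SucI) blast
  have mem: "{x} \<in> V k" for k using G by (simp add: V_def)
  have freq: "\<exists>\<^sub>F n in sequentially. \<exists>C\<in>V k. ?P n C" for k
  proof -
    let ?U = "ball x (inverse (Suc k)) \<inter> G"
    have "open ?U" "x \<in> ?U" using G by auto
    then have "\<exists>\<^sub>F n in sequentially. ?P n ?U"
      using contra by (auto simp: not_eventually not_le)
    then show ?thesis
    proof (rule frequently_elim1)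
      fix n assume "?P n ?U"
      interpret prob_space "\<mu> n" by (rule borel_probsD(1)[OF \<mu>])
      have "emeasure (\<mu> n) ?U = (SUP C\<in>{C. C \<subseteq> ?U \<and> compact C}. emeasure (\<mu> n) C)"
        using \<open>open ?U\<close> borel_probsD[OF \<mu>] by (intro inner_regular) auto
      with \<open>?P n ?U\<close> show "\<exists>C\<in>V k. ?P n C"
        by (auto simp: less_SUP_iff V_def)
    qed
  qed
  obtain C where C: "\<And>n. C n \<in> V 0" "\<And>k. \<forall>\<^sub>F n in sequentially. C n \<in> V k"
    "\<exists>\<^sub>F n in sequentially. ?P n (C n)"
    using diagonal_selection[OF dec mem freq] by blast
  define K where "K = {x} \<union> (\<Union>n. C n)"
  have "compact K" unfolding K_def
  proof (rule compact_Un_converging_compacts)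
    show "compact (C n)" for n using C(1) by (simp add: V_def)
    fix U assume "open U" "{x} \<subseteq> U"
    then obtain e where e: "e > 0" "ball x e \<subseteq> U" using open_contains_ball by blast
    obtain k where "inverse (real (Suc k)) < e" using reals_Archimedean[OF e(1)] by auto
    then have "ball x (inverse (Suc k)) \<subseteq> ball x e" by (intro subset_ball) simp
    with e(2) have *: "D \<subseteq> U" if "D \<in> V k" for D using that by (auto simp: V_def)
    have "\<forall>\<^sub>F n in sequentially. C n \<in> V k" using C(2) by blast
    then show "\<forall>\<^sub>F n in sequentially. C n \<subseteq> U" by (rule eventually_mono) (rule *)
  qed simp
  have "K \<subseteq> G" using C(1) G(2) by (auto simp: K_def V_def)
  then have "ereal t' \<le> (INF y\<in>K. enn2ereal (I y))"
    by (intro INF_greatest) (auto simp: G_def)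
  then have "- (INF y\<in>K. enn2ereal (I y)) \<le> - ereal t'" by (simp only: ereal_minus_le_minus)
  also have "\<dots> < ereal (- t)" using t'(1) by simp
  finally have "\<forall>\<^sub>F n in sequentially. emeasure (\<mu> n) K \<le> ennreal (exp (a n * (- t)))"
    using P1 \<open>compact K\<close> unfolding ld_weak_upper_bound_def limsup_scaled_ln_le_iff[OF a] by blast
  with C(3) have "\<exists>\<^sub>F n in sequentially. ?P n (C n) \<and> emeasure (\<mu> n) K \<le> ennreal (exp (a n * (- t)))"
    by (rule frequently_eventually_frequently)
  then obtain n where n: "?P n (C n)" "emeasure (\<mu> n) K \<le> ennreal (exp (- (a n * t)))"
    using frequently_ex by auto
  have "emeasure (\<mu> n) (C n) \<le> emeasure (\<mu> n) K"
    using borel_probsD[OF \<mu>] \<open>compact K\<close> by (intro emeasure_mono) (auto simp: K_def compact_imp_closed)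
  with n show False by (meson leD order_less_le_trans order_trans)
qed

lemma local_decay_near_compact:
  assumes a: "filterlim a at_top sequentially" and \<mu>: "\<And>n. \<mu> n \<in> borel_probs"
    and loc: "local_decay \<mu> a I" and K: "compact K" and t: "ereal t < (INF x\<in>K. enn2ereal (I x))"
  obtains U where "open U" "K \<subseteq> U"
    "\<forall>\<^sub>F n in sequentially. emeasure (\<mu> n) U \<le> ennreal (exp (- (a n * t)))"
proof -
  obtain t' where t': "ereal t < ereal t'" "ereal t' < (INF x\<in>K. enn2ereal (I x))"
    using ereal_dense2[OF t] by blast
  obtain U where U: "open U" "K \<subseteq> U"
    "\<forall>\<^sub>F n in sequentially. emeasure (\<mu> n) U \<le> ennreal (exp (a n * (- t)))"
  proof (rule compact_subadditive_decay[OF a K, of "\<lambda>n. emeasure (\<mu> n)" "- t'" "- t"])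
    show "emeasure (\<mu> n) (U \<union> V) \<le> emeasure (\<mu> n) U + emeasure (\<mu> n) V"
      if "open U" "open V" for n U V
      using borel_probsD[OF \<mu>] that by (intro emeasure_subadditive) auto
    show "\<exists>U. open U \<and> x \<in> U \<and>
        (\<forall>\<^sub>F n in sequentially. emeasure (\<mu> n) U \<le> ennreal (exp (a n * - t')))" if "x \<in> K" for x
      using loc less_INF_D[OF t'(2) that] unfolding local_decay_def by simp
  qed (use t'(1) in auto)
  then show thesis using that by simp
qed

section \<open>Compact sets in the Hausdorff topology\<close>

text \<open>The compact subsets of an open set \<open>U\<close> form an open set of compact sets, because a compact
  subset of \<open>U\<close> has a whole \<open>d\<close>-enlargement inside \<open>U\<close>.\<close>

lemma limitin_hausdorff_imp_eventually_subset:
  fixes d :: "'a::metric_space \<Rightarrow> 'a \<Rightarrow> real"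
  assumes d: "Metric_space UNIV d" "Metric_space.mtopology UNIV d = euclidean"
    and lim: "limitin (hausdorff_topology d) C K sequentially" and U: "open U" "K \<subseteq> U"
  shows "\<forall>\<^sub>F n in sequentially. C n \<subseteq> U"
proof -
  interpret Metric_space UNIV d by (rule d(1))
  have opn: "open W \<longleftrightarrow> (\<forall>x\<in>W. \<exists>r>0. mball x r \<subseteq> W)" for W
    using openin_mtopology[of W] d(2) by auto
  have enl: "\<exists>\<epsilon>>0. enlargement d K' \<epsilon> \<subseteq> U" if K': "compact K'" "K' \<subseteq> U" for K'
  proof -
    have "\<forall>x\<in>K'. \<exists>r>0. mball x (2 * r) \<subseteq> U"
    proof
      fix x assume "x \<in> K'"
      then have "x \<in> U" using K'(2) by blast
      then obtain r where "r > 0" "mball x r \<subseteq> U" using U(1)[unfolded opn] by metis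
      then show "\<exists>r>0. mball x (2 * r) \<subseteq> U" by (intro exI[of _ "r / 2"]) auto
    qed
    then obtain r where r: "\<And>x. x \<in> K' \<Longrightarrow> r x > 0" "\<And>x. x \<in> K' \<Longrightarrow> mball x (2 * r x) \<subseteq> U"
      by metis
    have "open (mball x (r x))" for x using openin_mball[of x] d(2) by simp
    moreover have "K' \<subseteq> (\<Union>x\<in>K'. mball x (r x))" using r(1) by auto
    ultimately obtain F where F: "F \<subseteq> K'" "finite F" "K' \<subseteq> (\<Union>x\<in>F. mball x (r x))"
      using compactE_image[OF K'(1), of K' "\<lambda>x. mball x (r x)"] by metis
    \<comment> \<open>a kind of Lebesgue number of the cover; the element 1 is there because \<open>F\<close> may be empty\<close>
    define \<epsilon> where "\<epsilon> = Min (insert 1 (r ` F))"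
    have "\<epsilon> > 0" "\<And>x. x \<in> F \<Longrightarrow> \<epsilon> \<le> r x" using F r(1) by (auto simp: \<epsilon>_def)
    moreover have "enlargement d K' \<epsilon> \<subseteq> U"
    proof
      fix z assume "z \<in> enlargement d K' \<epsilon>"
      then obtain y where y: "y \<in> K'" "d z y < \<epsilon>" by (auto simp: enlargement_def)
      then obtain x where x: "x \<in> F" "d x y < r x" using F(3) by auto
      have "d x z \<le> d x y + d y z" by (simp add: triangle)
      also have "\<dots> < 2 * r x"
        using x y calculation \<open>\<And>x. x \<in> F \<Longrightarrow> \<epsilon> \<le> r x\<close>[OF x(1)] by (simp add: commute[of y z])
      finally have "z \<in> mball x (2 * r x)" by simp
      then show "z \<in> U" using r(2) x(1) F(1) by blast
    qed
    ultimately show ?thesis by blast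
  qed
  let ?O = "{K'. compact K' \<and> K' \<subseteq> U}"
  have "openin (hausdorff_topology d) ?O"
    unfolding openin_hausdorff_topology
  proof (intro conjI ballI)
    fix K' assume "K' \<in> ?O"
    then obtain \<epsilon> where \<epsilon>: "\<epsilon> > 0" "enlargement d K' \<epsilon> \<subseteq> U" using enl[of K'] by blast
    have "hausdorff_ball d K' \<epsilon> \<subseteq> ?O"
    proof
      fix K'' assume "K'' \<in> hausdorff_ball d K' \<epsilon>"
      then obtain \<delta> where "compact K''" "\<delta> < \<epsilon>" "K'' \<subseteq> enlargement d K' \<delta>"
        by (auto simp: hausdorff_ball_def hausdorff_dist_def Inf_less_iff)
      moreover have "enlargement d K' \<delta> \<subseteq> enlargement d K' \<epsilon>"
        using \<open>\<delta> < \<epsilon>\<close> by (force simp: enlargement_def)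
      ultimately show "K'' \<in> ?O" using \<epsilon>(2) by auto
    qed
    with \<epsilon>(1) show "\<exists>\<epsilon>>0. hausdorff_ball d K' \<epsilon> \<subseteq> ?O" by blast
  qed auto
  moreover have "K \<in> ?O"
    using limitin_topspace[OF lim] U(2) by (simp add: topspace_hausdorff_topology)
  ultimately have "\<forall>\<^sub>F n in sequentially. C n \<in> ?O"
    using lim unfolding limitin_def by blast
  then show ?thesis by (auto elim: eventually_mono)
qed

lemma local_decay_imp_Gamma_liminf_neg_log_mass:
  fixes \<mu> :: "nat \<Rightarrow> 'a::metric_space measure"
  assumes d: "Metric_space UNIV d" "Metric_space.mtopology UNIV d = euclidean"
    and a: "\<And>n. a n > 0" "filterlim a at_top sequentially" and \<mu>: "\<And>n. \<mu> n \<in> borel_probs"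
    and loc: "local_decay \<mu> a I" and K: "compact K"
  shows "(INF x\<in>K. enn2ereal (I x)) \<le> Gamma_liminf (hausdorff_topology d) (neg_log_mass \<mu> a) K"
proof (rule Gamma_liminf_geI)
  fix C assume C: "limitin (hausdorff_topology d) C K sequentially"
  have "limsup (\<lambda>n. ereal (1 / a n) * ln_ennreal (emeasure (\<mu> n) (C n)))
      \<le> - (INF x\<in>K. enn2ereal (I x))"
    unfolding limsup_scaled_ln_le_iff[OF a(1)]
  proof (intro allI impI)
    fix t assume "- (INF x\<in>K. enn2ereal (I x)) < ereal t"
    then have "ereal (- t) < (INF x\<in>K. enn2ereal (I x))"
      by (metis ereal_minus_less_minus ereal_uminus_uminus uminus_ereal.simps(1))
    then obtain U where U: "open U" "K \<subseteq> U"
        "\<forall>\<^sub>F n in sequentially. emeasure (\<mu> n) U \<le> ennreal (exp (- (a n * (- t))))"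
      using local_decay_near_compact[OF a(2) \<mu> loc K] by blast
    from limitin_hausdorff_imp_eventually_subset[OF d C U(1,2)] U(3)
    show "\<forall>\<^sub>F n in sequentially. emeasure (\<mu> n) (C n) \<le> ennreal (exp (a n * t))"
    proof eventually_elim
      case (elim n)
      have "emeasure (\<mu> n) (C n) \<le> emeasure (\<mu> n) U"
        using elim(1) U(1) borel_probsD[OF \<mu>] by (intro emeasure_mono) auto
      with elim(2) show ?case by simp
    qed
  qed
  then have "(INF x\<in>K. enn2ereal (I x)) \<le>
      - limsup (\<lambda>n. ereal (1 / a n) * ln_ennreal (emeasure (\<mu> n) (C n)))"
    by (subst ereal_minus_le_minus[symmetric]) simp
  also have "\<dots> = liminf (\<lambda>n. neg_log_mass \<mu> a n (C n))"
    by (simp add: neg_log_mass_def ereal_Liminf_uminus)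
  finally show "(INF x\<in>K. enn2ereal (I x)) \<le> liminf (\<lambda>n. neg_log_mass \<mu> a n (C n))" .
qed

text \<open>Constant sequences of compact sets suffice.\<close>

lemma Gamma_liminf_neg_log_mass_imp_ld_weak_upper_bound:
  assumes L: "\<And>K. compact K \<Longrightarrow>
    (INF x\<in>K. enn2ereal (I x)) \<le> Gamma_liminf (hausdorff_topology d) (neg_log_mass \<mu> a) K"
  shows "ld_weak_upper_bound \<mu> a I"
  unfolding ld_weak_upper_bound_def
proof (intro allI impI)
  fix K :: "'a set" assume "compact K"
  then have "Gamma_liminf (hausdorff_topology d) (neg_log_mass \<mu> a) K
      \<le> liminf (\<lambda>n. neg_log_mass \<mu> a n K)"
    unfolding Gamma_liminf_def
    by (intro INF_lower) (auto simp: topspace_hausdorff_topology)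
  with L[OF \<open>compact K\<close>] have "(INF x\<in>K. enn2ereal (I x)) \<le> liminf (\<lambda>n. neg_log_mass \<mu> a n K)"
    by (rule order_trans)
  also have "\<dots> = - limsup (\<lambda>n. ereal (1 / a n) * ln_ennreal (emeasure (\<mu> n) K))"
    by (simp add: neg_log_mass_def ereal_Liminf_uminus)
  finally show "limsup (\<lambda>n. ereal (1 / a n) * ln_ennreal (emeasure (\<mu> n) K))
      \<le> - (INF x\<in>K. enn2ereal (I x))"
    by (subst (asm) ereal_minus_le_minus[symmetric]) simp
qed

section \<open>Laplace upper bounds\<close>

lemma measurable_exp_ereal [measurable]: "exp_ereal \<in> borel_measurable borel"
proof -
  have eq: "exp_ereal = (\<lambda>t. if t = \<infinity> then \<infinity> else if t = - \<infinity> then 0 else ennreal (exp (real_of_ereal t)))"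
    by (rule ext) (auto simp: exp_ereal_def split: ereal.split)
  show ?thesis unfolding eq by measurable
qed

lemma exp_ereal_ereal [simp]: "exp_ereal (ereal r) = ennreal (exp r)"
  by (simp add: exp_ereal_def)

lemma exp_ereal_0 [simp]: "exp_ereal 0 = 1"
  using exp_ereal_ereal[of 0] by (simp flip: zero_ereal_def)

lemma exp_ereal_neg_mult_le:
  assumes "ereal q \<le> p" "a > 0"
  shows "exp_ereal (- (ereal a * p)) \<le> ennreal (exp (- (a * q)))"
  using assms by (cases p) (auto simp: exp_ereal_def intro!: ennreal_leI)

lemma measurable_bounded_below_lower_bound:
  assumes "measurable_bounded_below \<phi>"
  obtains c :: real where "\<And>n x. ereal c < \<phi> n x"
proof -
  from assms have "- \<infinity> < (INF n. INF x. \<phi> n x)" by (simp add: measurable_bounded_below_def)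
  then obtain c where "ereal c < (INF n. INF x. \<phi> n x)" using ereal_dense2 by blast
  then have "ereal c < \<phi> n x" for n x by (meson UNIV_I less_INF_D)
  then show thesis by (rule that)
qed

lemma nn_integral_weight_le_emeasure:
  assumes \<mu>: "\<mu> \<in> borel_probs" and "a > 0" and "A \<in> sets borel"
    and "\<And>x. x \<in> A \<Longrightarrow> ereal q \<le> \<phi> x"
  shows "(\<integral>\<^sup>+x\<in>A. exp_ereal (- (ereal a * \<phi> x)) \<partial>\<mu>) \<le> ennreal (exp (- (a * q))) * emeasure \<mu> A"
proof -
  have "(\<integral>\<^sup>+x\<in>A. exp_ereal (- (ereal a * \<phi> x)) \<partial>\<mu>)
      \<le> (\<integral>\<^sup>+x. ennreal (exp (- (a * q))) * indicator A x \<partial>\<mu>)"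
    using assms by (intro nn_integral_mono) (auto simp: indicator_def intro: exp_ereal_neg_mult_le)
  also have "\<dots> = ennreal (exp (- (a * q))) * emeasure \<mu> A"
    using assms borel_probsD[OF \<mu>] by (simp add: nn_integral_cmult_indicator)
  finally show ?thesis .
qed

text \<open>Near a point \<open>x\<close>, the weight is at most \<open>exp (- a\<^sub>n p)\<close> with \<open>p\<close> just below the \<open>\<Gamma>\<close>-lower limit of
  \<open>\<phi>\<close> at \<open>x\<close>, and the mass is at most \<open>exp (- a\<^sub>n q)\<close> with \<open>q\<close> just below \<open>I x\<close>. The product is the local
  estimate that compactness propagates to a neighbourhood of \<open>K\<close>. That the bound holds on an open set
  and not only on \<open>K\<close> is what the entropy estimate relies on.\<close>

lemma local_decay_laplace_near_compact:
  fixes \<mu> :: "nat \<Rightarrow> 'a::metric_space measure"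
  assumes a: "\<And>n. a n > 0" "filterlim a at_top sequentially" and \<mu>: "\<And>n. \<mu> n \<in> borel_probs"
    and loc: "local_decay \<mu> a I" and \<phi>: "measurable_bounded_below \<phi>" and K: "compact K"
    and t: "(SUP x. if I x = \<infinity> then -\<infinity> else - Gamma_liminf euclidean \<phi> x - enn2ereal (I x))
      < ereal t" (is "?S < _")
  obtains U where "open U" "K \<subseteq> U"
    "\<forall>\<^sub>F n in sequentially.
      (\<integral>\<^sup>+x\<in>U. exp_ereal (- (ereal (a n) * \<phi> n x)) \<partial>\<mu> n) \<le> ennreal (exp (a n * t))"
proof -
  let ?g = "\<lambda>n x. exp_ereal (- (ereal (a n) * \<phi> n x))"
  obtain t' where t': "?S < ereal t'" "ereal t' < ereal t" using ereal_dense2[OF t] by blast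
  obtain c where c: "\<And>n x. ereal c < \<phi> n x"
    using measurable_bounded_below_lower_bound[OF \<phi>] by blast
  have [measurable]: "\<phi> n \<in> borel_measurable (\<mu> n)" for n
    using \<phi> measurable_cong_sets[OF borel_probsD(2)[OF \<mu>] refl]
    by (auto simp: measurable_bounded_below_def)
  have meas: "U \<in> sets (\<mu> n)" if "open U" for U n
    using that borel_probsD(2)[OF \<mu>] by simp
  have near: "\<exists>U. open U \<and> x \<in> U \<and>
      (\<forall>\<^sub>F n in sequentially. (\<integral>\<^sup>+x\<in>U. ?g n x \<partial>\<mu> n) \<le> ennreal (exp (a n * t')))" for x
  proof -
    have S: "(if I x = \<infinity> then -\<infinity> else - Gamma_liminf euclidean \<phi> x - enn2ereal (I x)) < ereal t'"
      by (rule le_less_trans[OF SUP_upper t'(1)]) simp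
    \<comment> \<open>split \<open>- t'\<close> into a lower bound \<open>p\<close> for \<open>\<phi>\<close> and a number below \<open>I x\<close>;
      where \<open>I x\<close> is infinite, the global lower bound of \<open>\<phi>\<close> serves as \<open>p\<close>\<close>
    have "\<exists>p. ereal (- t' - p) < enn2ereal (I x) \<and>
      (\<exists>V. open V \<and> x \<in> V \<and> (\<forall>\<^sub>F n in sequentially. \<forall>y\<in>V. ereal p < \<phi> n y))"
    proof (cases "I x = \<infinity>")
      case True
      with c show ?thesis by (intro exI[of _ c] conjI exI[of _ UNIV]) auto
    next
      case False
      then obtain i where i: "I x = ennreal i" "i \<ge> 0" by (cases "I x") auto
      with S False have "ereal (- t' - i) < Gamma_liminf euclidean \<phi> x"
        by (cases "Gamma_liminf euclidean \<phi> x") (auto simp: enn2ereal_ennreal)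
      then obtain p where p: "ereal (- t' - i) < ereal p" "ereal p < Gamma_liminf euclidean \<phi> x"
        using ereal_dense2 by blast
      obtain V where "open V" "x \<in> V" "\<forall>\<^sub>F n in sequentially. \<forall>y\<in>V. ereal p < \<phi> n y"
        using Gamma_liminf_euclidean_gt_imp_locally_gt[OF p(2)] by blast
      moreover have "ereal (- t' - p) < enn2ereal (I x)"
        using p(1) i by (simp add: enn2ereal_ennreal)
      ultimately show ?thesis by blast
    qed
    then obtain p V where p: "ereal (- t' - p) < enn2ereal (I x)" and V: "open V" "x \<in> V"
      "\<forall>\<^sub>F n in sequentially. \<forall>y\<in>V. ereal p < \<phi> n y" by blast
    from loc p obtain W where W: "open W" "x \<in> W"
      "\<forall>\<^sub>F n in sequentially. emeasure (\<mu> n) W \<le> ennreal (exp (- (a n * (- t' - p))))"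
      unfolding local_decay_def by blast
    from V(3) W(3)
    have "\<forall>\<^sub>F n in sequentially. (\<integral>\<^sup>+x\<in>V \<inter> W. ?g n x \<partial>\<mu> n) \<le> ennreal (exp (a n * t'))"
    proof eventually_elim
      case (elim n)
      have "(\<integral>\<^sup>+x\<in>V \<inter> W. ?g n x \<partial>\<mu> n) \<le> ennreal (exp (- (a n * p))) * emeasure (\<mu> n) (V \<inter> W)"
        using elim(1) V(1) W(1)
        by (intro nn_integral_weight_le_emeasure \<mu> a) (auto intro: less_imp_le)
      also have "\<dots> \<le> ennreal (exp (- (a n * p))) * ennreal (exp (- (a n * (- t' - p))))"
        using elim(2) by (intro mult_left_mono order_trans[OF emeasure_mono elim(2)])
          (auto simp: meas W(1))
      also have "\<dots> = ennreal (exp (a n * t'))"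
        by (simp add: algebra_simps flip: ennreal_mult exp_add)
      finally show ?case .
    qed
    then show ?thesis using V(1,2) W(1,2) by (intro exI[of _ "V \<inter> W"]) auto
  qed
  show thesis
  proof (rule compact_subadditive_decay[OF a(2) K, of "\<lambda>n U. \<integral>\<^sup>+x\<in>U. ?g n x \<partial>\<mu> n" t' t])
    fix n and U V :: "'a set" assume "open U" "open V"
    note [measurable] = meas[OF \<open>open U\<close>, of n] meas[OF \<open>open V\<close>, of n]
    have "(\<integral>\<^sup>+x\<in>U \<union> V. ?g n x \<partial>\<mu> n) \<le> (\<integral>\<^sup>+x. ?g n x * indicator U x + ?g n x * indicator V x \<partial>\<mu> n)"
      by (intro nn_integral_mono) (auto simp: indicator_def)
    also have "\<dots> = (\<integral>\<^sup>+x\<in>U. ?g n x \<partial>\<mu> n) + (\<integral>\<^sup>+x\<in>V. ?g n x \<partial>\<mu> n)"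
      by (intro nn_integral_add) measurable
    finally show "(\<integral>\<^sup>+x\<in>U \<union> V. ?g n x \<partial>\<mu> n) \<le> (\<integral>\<^sup>+x\<in>U. ?g n x \<partial>\<mu> n) + (\<integral>\<^sup>+x\<in>V. ?g n x \<partial>\<mu> n)" .
  qed (use near t'(2) that in auto)
qed

lemma laplace_split:
  assumes \<mu>: "\<mu> \<in> borel_probs" and \<phi>: "\<phi> \<in> borel_measurable borel" and K: "K \<in> sets borel"
  shows "(\<integral>\<^sup>+x. exp_ereal (- (ereal a * \<phi> x)) \<partial>\<mu>) =
    (\<integral>\<^sup>+x\<in>K. exp_ereal (- (ereal a * \<phi> x)) \<partial>\<mu>) + (\<integral>\<^sup>+x\<in>-K. exp_ereal (- (ereal a * \<phi> x)) \<partial>\<mu>)"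
proof -
  have [measurable]: "\<phi> \<in> borel_measurable \<mu>" "K \<in> sets \<mu>" "- K \<in> sets \<mu>"
    using \<phi> K measurable_cong_sets[OF borel_probsD(2)[OF \<mu>] refl] borel_probsD(2)[OF \<mu>]
    by auto
  have "(\<integral>\<^sup>+x. exp_ereal (- (ereal a * \<phi> x)) \<partial>\<mu>) =
    (\<integral>\<^sup>+x. exp_ereal (- (ereal a * \<phi> x)) * indicator K x
      + exp_ereal (- (ereal a * \<phi> x)) * indicator (- K) x \<partial>\<mu>)"
    by (intro nn_integral_cong) (auto simp: indicator_def)
  also have "\<dots> = (\<integral>\<^sup>+x\<in>K. exp_ereal (- (ereal a * \<phi> x)) \<partial>\<mu>)
      + (\<integral>\<^sup>+x\<in>-K. exp_ereal (- (ereal a * \<phi> x)) \<partial>\<mu>)"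
    by (intro nn_integral_add) measurable
  finally show ?thesis .
qed

text \<open>Common part of the two tight cases: the whole integral is dominated by the one over a compact set,
  up to a factor and up to an error of arbitrarily fast exponential decay.\<close>

lemma local_decay_imp_laplace_upper_bound_if_compact_dominates:
  fixes \<mu> :: "nat \<Rightarrow> 'a::metric_space measure"
  assumes a: "\<And>n. a n > 0" "filterlim a at_top sequentially" and \<mu>: "\<And>n. \<mu> n \<in> borel_probs"
    and loc: "local_decay \<mu> a I" and \<phi>: "measurable_bounded_below \<phi>"
    and dom: "\<And>t. \<exists>K. compact K \<and> (\<forall>\<^sub>F n in sequentially.
      (\<integral>\<^sup>+x. exp_ereal (- (ereal (a n) * \<phi> n x)) \<partial>\<mu> n) \<le>
      2 * (\<integral>\<^sup>+x\<in>K. exp_ereal (- (ereal (a n) * \<phi> n x)) \<partial>\<mu> n) + ennreal (exp (a n * t)))"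
  shows "laplace_upper_bound \<mu> a I \<phi>"
  unfolding laplace_upper_bound_def limsup_scaled_ln_le_iff[OF a(1)]
proof (intro allI impI)
  let ?g = "\<lambda>n x. exp_ereal (- (ereal (a n) * \<phi> n x))"
  fix t assume t: "(SUP x. if I x = \<infinity> then -\<infinity> else - Gamma_liminf euclidean \<phi> x - enn2ereal (I x))
    < ereal t"
  obtain t' where t': "(SUP x. if I x = \<infinity> then -\<infinity> else - Gamma_liminf euclidean \<phi> x - enn2ereal (I x))
    < ereal t'" "ereal t' < ereal t" using ereal_dense2[OF t] by blast
  obtain K where K: "compact K" "\<forall>\<^sub>F n in sequentially. (\<integral>\<^sup>+x. ?g n x \<partial>\<mu> n) \<le>
      2 * (\<integral>\<^sup>+x\<in>K. ?g n x \<partial>\<mu> n) + ennreal (exp (a n * t'))"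
    using dom by blast
  obtain U where U: "open U" "K \<subseteq> U"
    "\<forall>\<^sub>F n in sequentially. (\<integral>\<^sup>+x\<in>U. ?g n x \<partial>\<mu> n) \<le> ennreal (exp (a n * t'))"
    using local_decay_laplace_near_compact[OF a \<mu> loc \<phi> K(1) t'(1)] by blast
  have "t' < t" using t'(2) by simp
  from K(2) U(3) eventually_mult_exp_le[OF a(2) this, of 3]
  show "\<forall>\<^sub>F n in sequentially. (\<integral>\<^sup>+x. ?g n x \<partial>\<mu> n) \<le> ennreal (exp (a n * t))"
  proof eventually_elim
    case (elim n)
    have "(\<integral>\<^sup>+x\<in>K. ?g n x \<partial>\<mu> n) \<le> (\<integral>\<^sup>+x\<in>U. ?g n x \<partial>\<mu> n)"
      using U(2) by (intro nn_integral_mono) (auto simp: indicator_def)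
    with elim(2) have "(\<integral>\<^sup>+x\<in>K. ?g n x \<partial>\<mu> n) \<le> ennreal (exp (a n * t'))" by (rule order_trans[rotated])
    then have "2 * (\<integral>\<^sup>+x\<in>K. ?g n x \<partial>\<mu> n) + ennreal (exp (a n * t'))
        \<le> 2 * ennreal (exp (a n * t')) + ennreal (exp (a n * t'))"
      by (intro add_right_mono mult_left_mono) auto
    also have "\<dots> = ennreal (2 * exp (a n * t')) + ennreal (exp (a n * t'))"
      by (simp add: ennreal_mult)
    also have "\<dots> = ennreal (3 * exp (a n * t'))"
      by (subst ennreal_plus[symmetric]) (auto simp: algebra_simps)
    also have "\<dots> \<le> ennreal (exp (a n * t))" using elim(3) by (rule ennreal_leI)
    finally show ?case using elim(1) by (rule order_trans[rotated])
  qed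
qed

text \<open>Asymptotic tightness of the weights puts at least half of the integral on a compact set for all
  large \<open>n\<close>.\<close>

lemma local_decay_imp_laplace_upper_bound_tight_weights:
  fixes \<mu> :: "nat \<Rightarrow> 'a::metric_space measure"
  assumes a: "\<And>n. a n > 0" "filterlim a at_top sequentially" and \<mu>: "\<And>n. \<mu> n \<in> borel_probs"
    and loc: "local_decay \<mu> a I" and \<phi>: "measurable_bounded_below \<phi>"
    and tight: "asymptotically_tight_weights \<mu> a \<phi>"
  shows "laplace_upper_bound \<mu> a I \<phi>"
proof (rule local_decay_imp_laplace_upper_bound_if_compact_dominates[OF a \<mu> loc \<phi>])
  fix t
  let ?g = "\<lambda>n x. exp_ereal (- (ereal (a n) * \<phi> n x))"
  obtain c where c: "\<And>n x. ereal c < \<phi> n x"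
    using measurable_bounded_below_lower_bound[OF \<phi>] by blast
  have "(INF K \<in> Collect compact. limsup (\<lambda>n.
      (\<integral>\<^sup>+x. indicator (- K) x * ?g n x \<partial>\<mu> n) / (\<integral>\<^sup>+x. ?g n x \<partial>\<mu> n))) < 1 / 2"
    using tight unfolding asymptotically_tight_weights_def by (simp add: ennreal_zero_less_divide)
  then obtain K where K: "compact K" "limsup (\<lambda>n.
      (\<integral>\<^sup>+x. indicator (- K) x * ?g n x \<partial>\<mu> n) / (\<integral>\<^sup>+x. ?g n x \<partial>\<mu> n)) < 1 / 2"
    unfolding INF_less_iff by blast
  from Limsup_lessD[OF K(2)]
  have "\<forall>\<^sub>F n in sequentially. (\<integral>\<^sup>+x. ?g n x \<partial>\<mu> n) \<le>
      2 * (\<integral>\<^sup>+x\<in>K. ?g n x \<partial>\<mu> n) + ennreal (exp (a n * t))"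
  proof eventually_elim
    case (elim n)
    define Z where "Z = (\<integral>\<^sup>+x. ?g n x \<partial>\<mu> n)"
    define A where "A = (\<integral>\<^sup>+x\<in>K. ?g n x \<partial>\<mu> n)"
    define B where "B = (\<integral>\<^sup>+x\<in>-K. ?g n x \<partial>\<mu> n)"
    have Z: "Z = A + B" unfolding Z_def A_def B_def
      using \<phi> K(1) by (intro laplace_split \<mu>) (auto simp: measurable_bounded_below_def compact_imp_closed)
    have "Z \<le> ennreal (exp (- (a n * c))) * emeasure (\<mu> n) UNIV"
      using nn_integral_weight_le_emeasure[OF \<mu> a(1), of UNIV c "\<phi> n" n] c
      by (simp add: Z_def less_imp_le)
    also have "\<dots> = ennreal (exp (- (a n * c)))"
      using borel_probsD(3)[OF \<mu>, of n] prob_space.emeasure_space_1[OF borel_probsD(1)[OF \<mu>, of n]]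
      by simp
    finally have "Z < \<infinity>" using le_less_trans by fastforce
    have "B / Z < 1 / 2" using elim by (simp add: Z_def B_def mult.commute)
    have "Z \<le> 2 * A"
    proof (cases Z; cases A; cases B)
      fix z x y assume *: "Z = ennreal z" "A = ennreal x" "B = ennreal y" "0 \<le> z" "0 \<le> x" "0 \<le> y"
      have zxy: "z = x + y" using Z * by (simp flip: ennreal_plus)
      show ?thesis
      proof (cases "z = 0")
        case False
        have "ennreal y / ennreal z = ennreal (y / z)" using False * by (intro divide_ennreal) auto
        moreover have "ennreal (1 / 2) = 1 / 2" using ennreal_divide_numeral[of 1 "num.Bit0 num.One"] by simp
        ultimately have "ennreal (y / z) < ennreal (1 / 2)"
          using \<open>B / Z < 1 / 2\<close> *(1,3) by metis
        then have "y / z < 1 / 2" using * by (subst (asm) ennreal_less_iff) auto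
        with False * have "2 * y < z" by (simp add: field_simps)
        then have "ennreal z \<le> ennreal (2 * x)" using zxy by (intro ennreal_leI) simp
        with * show ?thesis by (simp add: ennreal_mult)
      qed (use * in simp)
    qed (use Z \<open>Z < \<infinity>\<close> in auto)
    also have "\<dots> \<le> 2 * A + ennreal (exp (a n * t))" by simp
    finally show ?case by (simp add: Z_def A_def)
  qed
  with K(1) show "\<exists>K. compact K \<and> (\<forall>\<^sub>F n in sequentially. (\<integral>\<^sup>+x. ?g n x \<partial>\<mu> n) \<le>
      2 * (\<integral>\<^sup>+x\<in>K. ?g n x \<partial>\<mu> n) + ennreal (exp (a n * t)))" by blast
qed

text \<open>Since \<open>\<phi>\<close> is bounded below, the weights grow at most exponentially, so exponential tightness
  makes the integral over the complement of a large compact set decay as fast as desired.\<close>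

lemma local_decay_imp_laplace_upper_bound_exponentially_tight:
  fixes \<mu> :: "nat \<Rightarrow> 'a::metric_space measure"
  assumes a: "\<And>n. a n > 0" "filterlim a at_top sequentially" and \<mu>: "\<And>n. \<mu> n \<in> borel_probs"
    and loc: "local_decay \<mu> a I" and \<phi>: "measurable_bounded_below \<phi>"
    and tight: "exponentially_tight \<mu> a"
  shows "laplace_upper_bound \<mu> a I \<phi>"
proof (rule local_decay_imp_laplace_upper_bound_if_compact_dominates[OF a \<mu> loc \<phi>])
  fix t
  let ?g = "\<lambda>n x. exp_ereal (- (ereal (a n) * \<phi> n x))"
  obtain c where c: "\<And>n x. ereal c < \<phi> n x"
    using measurable_bounded_below_lower_bound[OF \<phi>] by blast
  have "(INF K \<in> Collect compact. limsup (\<lambda>n. ereal (1 / a n) * ln_ennreal (emeasure (\<mu> n) (- K))))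
      < ereal (t + c)"
    using tight by (simp add: exponentially_tight_def)
  then obtain K where K: "compact K"
      "limsup (\<lambda>n. ereal (1 / a n) * ln_ennreal (emeasure (\<mu> n) (- K))) < ereal (t + c)"
    unfolding INF_less_iff by blast
  then have "\<forall>\<^sub>F n in sequentially. emeasure (\<mu> n) (- K) \<le> ennreal (exp (a n * (t + c)))"
    using limsup_scaled_ln_le_iff[OF a(1), THEN iffD1, OF order_refl] by simp
  then have "\<forall>\<^sub>F n in sequentially. (\<integral>\<^sup>+x. ?g n x \<partial>\<mu> n) \<le>
      2 * (\<integral>\<^sup>+x\<in>K. ?g n x \<partial>\<mu> n) + ennreal (exp (a n * t))"
  proof eventually_elim
    case (elim n)
    have "(\<integral>\<^sup>+x\<in>-K. ?g n x \<partial>\<mu> n) \<le> ennreal (exp (- (a n * c))) * emeasure (\<mu> n) (- K)"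
      using c K(1) by (intro nn_integral_weight_le_emeasure \<mu> a)
        (auto simp: less_imp_le compact_imp_closed)
    also have "\<dots> \<le> ennreal (exp (- (a n * c))) * ennreal (exp (a n * (t + c)))"
      using elim by (intro mult_left_mono) auto
    also have "\<dots> = ennreal (exp (a n * t))"
      by (simp add: algebra_simps flip: ennreal_mult exp_add)
    finally have B: "(\<integral>\<^sup>+x\<in>-K. ?g n x \<partial>\<mu> n) \<le> ennreal (exp (a n * t))" .
    have "(\<integral>\<^sup>+x. ?g n x \<partial>\<mu> n) = (\<integral>\<^sup>+x\<in>K. ?g n x \<partial>\<mu> n) + (\<integral>\<^sup>+x\<in>-K. ?g n x \<partial>\<mu> n)"
      using \<phi> K(1) by (intro laplace_split \<mu>) (auto simp: measurable_bounded_below_def compact_imp_closed)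
    also have "\<dots> \<le> 2 * (\<integral>\<^sup>+x\<in>K. ?g n x \<partial>\<mu> n) + ennreal (exp (a n * t))"
      using B by (intro add_mono) (auto simp: mult_2)
    finally show ?case .
  qed
  with K(1) show "\<exists>K. compact K \<and> (\<forall>\<^sub>F n in sequentially. (\<integral>\<^sup>+x. ?g n x \<partial>\<mu> n) \<le>
      2 * (\<integral>\<^sup>+x\<in>K. ?g n x \<partial>\<mu> n) + ennreal (exp (a n * t)))" by blast
qed

text \<open>The weight \<open>exp (- a \<phi>)\<close> for \<open>\<phi> = barrier C\<close> is the indicator of \<open>C\<close>, so that Laplace integrals
  become masses of \<open>C\<close>.\<close>

definition barrier :: "'a set \<Rightarrow> 'a \<Rightarrow> ereal" where
  "barrier C x = (if x \<in> C then 0 else \<infinity>)"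

lemma measurable_bounded_below_barrier:
  assumes "closed C"
  shows "measurable_bounded_below (\<lambda>_. barrier C)"
proof -
  have "C \<in> sets borel" using assms by simp
  then have "barrier C \<in> borel_measurable borel" unfolding barrier_def by (intro measurable_If_set) auto
  moreover have "(INF x. barrier C x) \<ge> 0" by (intro INF_greatest) (simp add: barrier_def)
  then have "- \<infinity> < (INF x. barrier C x)" by (rule less_le_trans[rotated]) simp
  ultimately show ?thesis by (simp add: measurable_bounded_below_def)
qed

lemma exp_ereal_barrier:
  assumes "a > 0"
  shows "exp_ereal (- (ereal a * barrier C x)) = indicator C x"
  using assms by (simp add: barrier_def) (simp add: exp_ereal_def)

text \<open>For closed \<open>C\<close> the barrier is lower semicontinuous, so it is below its own \<open>\<Gamma>\<close>-lower limit and the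
  supremum on the Laplace side only sees points of \<open>C\<close>.\<close>

lemma laplace_upper_bound_barrier_imp:
  fixes \<mu> :: "nat \<Rightarrow> 'a::metric_space measure"
  assumes a: "\<And>n. a n > 0" and \<mu>: "\<And>n. \<mu> n \<in> borel_probs" and C: "closed C"
    and lap: "laplace_upper_bound \<mu> a I (\<lambda>_. barrier C)"
  shows "limsup (\<lambda>n. ereal (1 / a n) * ln_ennreal (emeasure (\<mu> n) C)) \<le> - (INF x\<in>C. enn2ereal (I x))"
proof -
  have *: "(if I x = \<infinity> then -\<infinity> else - Gamma_liminf euclidean (\<lambda>_. barrier C) x - enn2ereal (I x))
      \<le> - (INF x\<in>C. enn2ereal (I x))" for x
  proof (cases "I x = \<infinity>")
    case False
    have bar: "barrier C x \<le> Gamma_liminf euclidean (\<lambda>_. barrier C) x"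
    proof (rule Gamma_liminf_geI)
      fix s assume s: "limitin euclidean s x sequentially"
      show "barrier C x \<le> liminf (\<lambda>n. barrier C (s n))"
      proof (cases "x \<in> C")
        case True
        then show ?thesis by (intro Liminf_bounded) (simp add: barrier_def)
      next
        case False
        have "\<forall>\<^sub>F n in sequentially. s n \<in> - C"
          using s C False by (intro topological_tendstoD[of s x]) auto
        then have "\<forall>\<^sub>F n in sequentially. barrier C x \<le> barrier C (s n)"
          by eventually_elim (simp add: barrier_def)
        then show ?thesis by (rule Liminf_bounded)
      qed
    qed
    have "- Gamma_liminf euclidean (\<lambda>_. barrier C) x - enn2ereal (I x) \<le> - barrier C x - enn2ereal (I x)"
      using bar by (intro ereal_minus_mono) auto
    also have "\<dots> \<le> - (INF x\<in>C. enn2ereal (I x))"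
    proof (cases "x \<in> C")
      case True
      then show ?thesis by (auto simp: barrier_def intro: INF_lower)
    next
      case c: False
      obtain i where "I x = ennreal i" "i \<ge> 0" using False by (cases "I x") auto
      with c show ?thesis by (simp add: barrier_def enn2ereal_ennreal)
    qed
    finally show ?thesis using False by simp
  qed simp
  have "(\<integral>\<^sup>+x. exp_ereal (- (ereal (a n) * barrier C x)) \<partial>\<mu> n) = emeasure (\<mu> n) C" for n
    using C borel_probsD(2)[OF \<mu>] by (simp add: exp_ereal_barrier a)
  with lap have "limsup (\<lambda>n. ereal (1 / a n) * ln_ennreal (emeasure (\<mu> n) C)) \<le>
    (SUP x. if I x = \<infinity> then -\<infinity> else - Gamma_liminf euclidean (\<lambda>_. barrier C) x - enn2ereal (I x))"
    by (simp add: laplace_upper_bound_def)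
  also have "\<dots> \<le> - (INF x\<in>C. enn2ereal (I x))" using * by (intro SUP_least)
  finally show ?thesis .
qed

lemma asymptotically_tight_weights_barrier:
  assumes a: "\<And>n. a n > 0" and K: "compact K"
  shows "asymptotically_tight_weights \<mu> a (\<lambda>_. barrier K)"
proof -
  have "limsup (\<lambda>n.
      (\<integral>\<^sup>+x. indicator (- K) x * exp_ereal (- (ereal (a n) * barrier K x)) \<partial>\<mu> n) /
      (\<integral>\<^sup>+x. exp_ereal (- (ereal (a n) * barrier K x)) \<partial>\<mu> n)) = (0 :: ennreal)"
    using a by (simp add: exp_ereal_barrier Limsup_const flip: indicator_inter_arith)
  moreover have "(INF K' \<in> Collect compact. limsup (\<lambda>n.
      (\<integral>\<^sup>+x. indicator (- K') x * exp_ereal (- (ereal (a n) * barrier K x)) \<partial>\<mu> n) /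
      (\<integral>\<^sup>+x. exp_ereal (- (ereal (a n) * barrier K x)) \<partial>\<mu> n))) \<le> limsup (\<lambda>n.
      (\<integral>\<^sup>+x. indicator (- K) x * exp_ereal (- (ereal (a n) * barrier K x)) \<partial>\<mu> n) /
      (\<integral>\<^sup>+x. exp_ereal (- (ereal (a n) * barrier K x)) \<partial>\<mu> n))"
    using K by (intro INF_lower) simp
  ultimately show ?thesis unfolding asymptotically_tight_weights_def by (simp only: le_zero_eq)
qed

section \<open>Narrow convergence and relative entropy\<close>

lemma topspace_narrow_topology: "topspace narrow_topology = borel_probs"
proof -
  have "borel_probs = {\<nu> \<in> borel_probs. (\<integral>x. (0::real) \<partial>\<nu>) \<in> UNIV}" by simp
  then have "borel_probs \<in> {{\<nu> \<in> borel_probs. (\<integral>x. f x \<partial>\<nu>) \<in> U} | (f :: 'a \<Rightarrow> real) U.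
        continuous_on UNIV f \<and> bounded (range f) \<and> open U}"
    by (intro CollectI exI[of _ "\<lambda>_. 0"] exI[of _ UNIV]) auto
  then show ?thesis
    unfolding narrow_topology_def topology_generated_by_topspace by blast
qed

lemma limitin_narrow_imp_tendsto_integral:
  fixes f :: "'a::topological_space \<Rightarrow> real"
  assumes lim: "limitin narrow_topology s \<nu> sequentially"
    and f: "continuous_on UNIV f" "bounded (range f)"
  shows "(\<lambda>n. \<integral>x. f x \<partial>s n) \<longlonglongrightarrow> (\<integral>x. f x \<partial>\<nu>)"
proof (rule topological_tendstoI)
  fix U :: "real set" assume U: "open U" "(\<integral>x. f x \<partial>\<nu>) \<in> U"
  let ?W = "{\<nu> \<in> borel_probs. (\<integral>x. f x \<partial>\<nu>) \<in> U}"
  have "openin narrow_topology ?W"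
    unfolding narrow_topology_def using f U(1) by (intro topology_generated_by_Basis) blast
  moreover have "\<nu> \<in> ?W"
    using U(2) limitin_topspace[OF lim] by (simp add: topspace_narrow_topology)
  ultimately have "\<forall>\<^sub>F n in sequentially. s n \<in> ?W" using lim unfolding limitin_def by blast
  then show "\<forall>\<^sub>F n in sequentially. (\<integral>x. f x \<partial>s n) \<in> U" by (auto elim: eventually_mono)
qed

lemma limitin_narrowI:
  assumes \<nu>: "\<nu> \<in> borel_probs" and s: "\<And>n. s n \<in> borel_probs"
    and conv: "\<And>f :: 'a::topological_space \<Rightarrow> real. continuous_on UNIV f \<Longrightarrow> bounded (range f) \<Longrightarrow>
      (\<lambda>n. \<integral>x. f x \<partial>s n) \<longlonglongrightarrow> (\<integral>x. f x \<partial>\<nu>)"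
  shows "limitin narrow_topology s \<nu> sequentially"
  unfolding limitin_def
proof (intro conjI allI impI)
  show "\<nu> \<in> topspace narrow_topology" using \<nu> by (simp add: topspace_narrow_topology)
  fix W :: "'a measure set" assume "openin narrow_topology W \<and> \<nu> \<in> W"
  then have "generate_topology_on {{\<nu> \<in> borel_probs. (\<integral>x. f x \<partial>\<nu>) \<in> U} | (f :: 'a \<Rightarrow> real) U.
        continuous_on UNIV f \<and> bounded (range f) \<and> open U} W" and "\<nu> \<in> W"
    by (auto simp: narrow_topology_def openin_topology_generated_by_iff)
  then show "\<forall>\<^sub>F n in sequentially. s n \<in> W"
  proof (induction rule: generate_topology_on.induct)
    case (Int A B)
    then show ?case by (auto intro: eventually_conj)
  next
    case (UN \<A>)
    then obtain A where "A \<in> \<A>" "\<nu> \<in> A" by blast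
    with UN.IH[of A] show ?case by (auto elim: eventually_mono)
  next
    case (Basis A)
    then obtain f :: "'a \<Rightarrow> real" and U where A: "A = {\<nu> \<in> borel_probs. (\<integral>x. f x \<partial>\<nu>) \<in> U}"
      and f: "continuous_on UNIV f" "bounded (range f)" and U: "open U" by blast
    from Basis A have "(\<integral>x. f x \<partial>\<nu>) \<in> U" by simp
    with conv[OF f] U have "\<forall>\<^sub>F n in sequentially. (\<integral>x. f x \<partial>s n) \<in> U"
      by (rule topological_tendstoD)
    then show ?case using s by (simp add: A)
  qed simp
qed

lemma bounded_imp_integrable_borel_prob:
  fixes f :: "'a::topological_space \<Rightarrow> real"
  assumes \<nu>: "\<nu> \<in> borel_probs" and f: "f \<in> borel_measurable borel" and bd: "\<And>x. \<bar>f x\<bar> \<le> B"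
  shows "integrable \<nu> f"
proof -
  interpret prob_space \<nu> by (rule borel_probsD(1)[OF \<nu>])
  have "f \<in> borel_measurable \<nu>"
    using f measurable_cong_sets[OF borel_probsD(2)[OF \<nu>] refl] by auto
  then show ?thesis using bd by (intro integrable_const_bound[of _ B]) auto
qed

text \<open>The integral of a bounded \<open>f\<close> that is continuous at \<open>x\<close> against a measure carried by a small ball around \<open>x\<close>
  is close to \<open>f x\<close>.\<close>

lemma limitin_narrow_return:
  fixes x :: "'a::metric_space"
  assumes s: "\<And>n. s n \<in> borel_probs"
    and conc: "\<And>k. \<forall>\<^sub>F n in sequentially. emeasure (s n) (ball x (inverse (real (Suc k)))) = 1"
  shows "limitin narrow_topology s (return borel x) sequentially"
proof (rule limitin_narrowI[OF _ s])
  show "return borel x \<in> borel_probs" by (simp add: borel_probs_def prob_space_return)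
  fix f :: "'a \<Rightarrow> real" assume f: "continuous_on UNIV f" "bounded (range f)"
  then have [measurable]: "f \<in> borel_measurable borel" by (intro borel_measurable_continuous_onI)
  obtain B where B: "\<And>y. \<bar>f y\<bar> \<le> B" using f(2) by (auto simp: bounded_iff)
  have "(\<lambda>n. \<integral>y. f y \<partial>s n) \<longlonglongrightarrow> f x"
  proof (rule tendstoI)
    fix e :: real assume "e > 0"
    have "isCont f x" using f(1) by (simp add: continuous_on_eq_continuous_at)
    then obtain \<delta> where \<delta>: "\<delta> > 0" "\<And>y. dist y x < \<delta> \<Longrightarrow> dist (f y) (f x) < e / 2"
      using \<open>e > 0\<close> unfolding continuous_at_eps_delta by (meson half_gt_zero)
    obtain k where k: "inverse (real (Suc k)) < \<delta>" using reals_Archimedean[OF \<delta>(1)] by auto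
    from conc[of k] show "\<forall>\<^sub>F n in sequentially. dist (\<integral>y. f y \<partial>s n) (f x) < e"
    proof eventually_elim
      case (elim n)
      interpret prob_space "s n" by (rule borel_probsD(1)[OF s])
      have sp: "space (s n) = UNIV" "sets (s n) = sets borel" by (simp_all add: borel_probsD[OF s])
      have "AE y in s n. y \<in> ball x (inverse (real (Suc k)))"
        using elim by (subst AE_in_set_eq_1) (simp_all add: sp measure_def del: of_nat_Suc)
      then have "AE y in s n. \<bar>f y - f x\<bar> \<le> e / 2"
      proof eventually_elim
        case (elim y)
        then have "dist y x < \<delta>" using k by (simp add: dist_commute)
        from \<delta>(2)[OF this] show ?case by (simp add: dist_real_def)
      qed
      moreover have "integrable (s n) f"
        using B by (intro bounded_imp_integrable_borel_prob[OF s, of _ B]) auto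
      then have int: "integrable (s n) (\<lambda>y. f y - f x)" "integrable (s n) f" by auto
      ultimately have "\<bar>\<integral>y. f y - f x \<partial>s n\<bar> \<le> e / 2"
      proof -
        assume ae: "AE y in s n. \<bar>f y - f x\<bar> \<le> e / 2"
        have "\<bar>\<integral>y. f y - f x \<partial>s n\<bar> \<le> (\<integral>y. \<bar>f y - f x\<bar> \<partial>s n)" by (rule integral_abs_bound)
        also have "\<dots> \<le> (\<integral>y. e / 2 \<partial>s n)"
          using ae int by (intro integral_mono_AE) auto
        finally show ?thesis using prob_space by simp
      qed
      also have "(\<integral>y. f y - f x \<partial>s n) = (\<integral>y. f y \<partial>s n) - f x"
        using int(2) prob_space by (subst Bochner_Integration.integral_diff) auto
      finally show ?case using \<open>e > 0\<close> by (simp add: dist_real_def)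
    qed
  qed
  then show "(\<lambda>n. \<integral>y. f y \<partial>s n) \<longlonglongrightarrow> (\<integral>y. f y \<partial>return borel x)"
    by (subst integral_return) auto
qed

text \<open>Jensen's inequality gives \<open>exp (\<nu>(\<phi>)) \<le> \<nu>(exp \<phi>)\<close> for the conditional measure \<open>\<nu>\<close>, and
  \<open>\<nu>(exp \<phi>) \<le> \<mu>(exp \<phi>) / \<mu>(A)\<close> because the exponential is positive.\<close>

lemma rel_entropy_uniform_measure_le:
  fixes \<mu> :: "'a::topological_space measure"
  assumes \<mu>: "\<mu> \<in> borel_probs" and A: "A \<in> sets borel" "measure \<mu> A > 0"
  shows "rel_entropy (uniform_measure \<mu> A) \<mu> \<le> ereal (- ln (measure \<mu> A))"
  unfolding rel_entropy_def
proof (rule SUP_least)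
  interpret \<mu>: prob_space \<mu> by (rule borel_probsD(1)[OF \<mu>])
  let ?\<nu> = "uniform_measure \<mu> A"
  let ?m = "measure \<mu> A"
  have A' [measurable]: "A \<in> sets \<mu>" using A(1) borel_probsD(2)[OF \<mu>] by simp
  have em: "emeasure \<mu> A = ennreal ?m" by (rule \<mu>.emeasure_eq_measure)
  interpret \<nu>: prob_space ?\<nu> using A(2) em by (intro prob_space_uniform_measure) auto
  have \<nu>: "?\<nu> \<in> borel_probs"
    using \<nu>.prob_space_axioms borel_probsD(2)[OF \<mu>] by (simp add: borel_probs_def)
  have dens: "?\<nu> = density \<mu> (\<lambda>x. ennreal (indicator A x / ?m))"
    unfolding uniform_measure_def em using A(2)
    by (intro arg_cong[of _ _ "density \<mu>"] ext) (simp add: divide_ennreal flip: ennreal_indicator)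
  fix \<phi> :: "'a \<Rightarrow> real"
  assume "\<phi> \<in> {\<phi>. \<phi> \<in> borel_measurable borel \<and> bounded (range \<phi>)}"
  then have m[measurable]: "\<phi> \<in> borel_measurable borel" and "bounded (range \<phi>)" by auto
  then obtain B where B: "\<And>x. \<bar>\<phi> x\<bar> \<le> B" by (auto simp: bounded_iff)
  then have eB: "\<bar>exp (\<phi> x)\<bar> \<le> exp B" for x using abs_le_D1[OF B] by simp
  have mexp: "(\<lambda>x. exp (\<phi> x)) \<in> borel_measurable borel" by measurable
  have m\<mu>: "(\<lambda>x. exp (\<phi> x)) \<in> borel_measurable \<mu>"
    by (subst measurable_cong_sets[OF borel_probsD(2)[OF \<mu>] refl]) (rule mexp)
  have int: "integrable ?\<nu> \<phi>" "integrable ?\<nu> (\<lambda>x. exp (\<phi> x))" "integrable \<mu> (\<lambda>x. exp (\<phi> x))"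
    using bounded_imp_integrable_borel_prob[OF \<nu> m B]
      bounded_imp_integrable_borel_prob[OF \<nu> mexp eB]
      bounded_imp_integrable_borel_prob[OF \<mu> mexp eB] by auto
  have "convex_on UNIV (exp :: real \<Rightarrow> real)" by (rule exp_convex)
  then have "exp (\<integral>x. \<phi> x \<partial>?\<nu>) \<le> (\<integral>x. exp (\<phi> x) \<partial>?\<nu>)"
    using int by (intro \<nu>.jensens_inequality[of _ UNIV]) auto
  also have "\<dots> = (\<integral>x. indicator A x / ?m * exp (\<phi> x) \<partial>\<mu>)"
    unfolding dens using m\<mu> by (subst integral_real_density) auto
  also have "\<dots> \<le> (\<integral>x. exp (\<phi> x) / ?m \<partial>\<mu>)"
  proof (rule integral_mono)
    show "integrable \<mu> (\<lambda>x. indicator A x / ?m * exp (\<phi> x))"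
      using integrable_real_mult_indicator[OF A' int(3)] by (simp add: mult.commute)
  qed (use int(3) in \<open>auto simp: indicator_def\<close>)
  also have "\<dots> = (\<integral>x. exp (\<phi> x) \<partial>\<mu>) / ?m" by simp
  finally have le: "exp (\<integral>x. \<phi> x \<partial>?\<nu>) \<le> (\<integral>x. exp (\<phi> x) \<partial>\<mu>) / ?m" .
  then have "0 < (\<integral>x. exp (\<phi> x) \<partial>\<mu>) / ?m" by (rule less_le_trans[rotated]) simp
  then have "0 < (\<integral>x. exp (\<phi> x) \<partial>\<mu>)" using A(2) by (simp add: zero_less_divide_iff)
  moreover from le have "(\<integral>x. \<phi> x \<partial>?\<nu>) \<le> ln ((\<integral>x. exp (\<phi> x) \<partial>\<mu>) / ?m)"
    using \<open>0 < (\<integral>x. exp (\<phi> x) \<partial>\<mu>) / ?m\<close> by (simp add: ln_ge_iff)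
  ultimately have "(\<integral>x. \<phi> x \<partial>?\<nu>) \<le> ln (\<integral>x. exp (\<phi> x) \<partial>\<mu>) - ln ?m"
    using A(2) by (simp add: ln_div)
  then show "ereal ((\<integral>x. \<phi> x \<partial>?\<nu>) - ln (\<integral>x. exp (\<phi> x) \<partial>\<mu>)) \<le> ereal (- ln ?m)" by simp
qed

text \<open>The variational formula, tested with \<open>a\<^sub>n \<psi>\<close>.\<close>

lemma scaled_entropy_ge_test_function:
  fixes \<psi> :: "'a::topological_space \<Rightarrow> real"
  assumes "a n > 0" and \<mu>: "\<mu> n \<in> borel_probs"
    and m[measurable]: "\<psi> \<in> borel_measurable borel" and bd: "\<And>x. \<bar>\<psi> x\<bar> \<le> B"
    and le: "(\<integral>\<^sup>+x. ennreal (exp (a n * \<psi> x)) \<partial>\<mu> n) \<le> ennreal (exp (a n * t))"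
  shows "ereal ((\<integral>x. \<psi> x \<partial>\<nu>) - t) \<le> scaled_entropy \<mu> a n \<nu>"
proof -
  interpret \<mu>: prob_space "\<mu> n" by (rule borel_probsD(1)[OF \<mu>])
  have b: "\<bar>a n * \<psi> x\<bar> \<le> a n * B" for x
    using bd[of x] \<open>a n > 0\<close> by (simp add: abs_mult)
  have e: "\<bar>exp (a n * \<psi> x)\<bar> \<le> exp (a n * B)" for x using b[of x] by simp
  have int: "integrable (\<mu> n) (\<lambda>x. exp (a n * \<psi> x))"
    by (rule bounded_imp_integrable_borel_prob[OF \<mu> _ e]) measurable
  have "exp (- (a n * B)) \<le> exp (a n * \<psi> x)" for x using b[of x] by simp
  then have "(\<integral>x. exp (- (a n * B)) \<partial>\<mu> n) \<le> (\<integral>x. exp (a n * \<psi> x) \<partial>\<mu> n)"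
    using int by (intro integral_mono) auto
  then have "exp (- (a n * B)) \<le> (\<integral>x. exp (a n * \<psi> x) \<partial>\<mu> n)" by (simp add: \<mu>.prob_space)
  then have pos: "0 < (\<integral>x. exp (a n * \<psi> x) \<partial>\<mu> n)" by (rule less_le_trans[rotated]) simp
  have "ennreal (\<integral>x. exp (a n * \<psi> x) \<partial>\<mu> n) \<le> ennreal (exp (a n * t))"
    using le nn_integral_eq_integral[OF int] by simp
  then have "(\<integral>x. exp (a n * \<psi> x) \<partial>\<mu> n) \<le> exp (a n * t)" by simp
  then have "ln (\<integral>x. exp (a n * \<psi> x) \<partial>\<mu> n) \<le> a n * t" using pos by (metis ln_exp ln_mono)
  then have "ereal (a n * ((\<integral>x. \<psi> x \<partial>\<nu>) - t))
      \<le> ereal ((\<integral>x. a n * \<psi> x \<partial>\<nu>) - ln (\<integral>x. exp (a n * \<psi> x) \<partial>\<mu> n))"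
    by (simp add: algebra_simps)
  also have "\<dots> \<le> rel_entropy \<nu> (\<mu> n)"
    unfolding rel_entropy_def using b
    by (intro SUP_upper) (auto simp: bounded_iff intro!: exI[of _ "a n * B"])
  finally have "ereal (1 / a n) * ereal (a n * ((\<integral>x. \<psi> x \<partial>\<nu>) - t)) \<le> scaled_entropy \<mu> a n \<nu>"
    unfolding scaled_entropy_def using \<open>a n > 0\<close> by (intro ereal_mult_left_mono) auto
  then show ?thesis using \<open>a n > 0\<close> by simp
qed

text \<open>Baire's approximation by the Lipschitz regularizations
  \<open>f\<^sub>k(x) = inf\<^sub>y (min (I y) k + k dist(x, y))\<close>. If \<open>I > u\<close> on the \<open>\<delta>\<close>-ball around \<open>x\<close>, then for large \<open>k\<close> the
  points \<open>y\<close> in the ball contribute at least \<open>u\<close> through the first summand and the others through the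
  second.\<close>

lemma lower_semicontinuous_approx:
  fixes I :: "'a::metric_space \<Rightarrow> ennreal"
  assumes I: "lower_semicontinuous I"
  obtains f :: "nat \<Rightarrow> 'a \<Rightarrow> real"
  where "\<And>k. continuous_on UNIV (f k)" "\<And>k x. 0 \<le> f k x" "\<And>k x. f k x \<le> real k"
    "\<And>k x. f k x \<le> f (Suc k) x" "\<And>x. (SUP k. ennreal (f k x)) = I x"
proof -
  define h where "h k y = enn2real (min (I y) (of_nat k))" for k y
  have h: "ennreal (h k y) = min (I y) (of_nat k)" for k y
    unfolding h_def by (rule ennreal_enn2real) (simp add: min_less_iff_disj of_nat_less_top)
  have h0: "0 \<le> h k y" for k y by (simp add: h_def)
  have hk: "h k y \<le> real k" for k y
  proof -
    have "ennreal (h k y) \<le> ennreal (real k)" by (simp add: h ennreal_of_nat_eq_real_of_nat)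
    then show ?thesis by simp
  qed
  have hmono: "h k y \<le> h (Suc k) y" for k y
  proof -
    have "(of_nat k :: ennreal) \<le> of_nat (Suc k)" by (intro of_nat_mono) simp
    then have "ennreal (h k y) \<le> ennreal (h (Suc k) y)" unfolding h by (intro min.mono) auto
    then show ?thesis using h0 by (simp add: ennreal_le_iff)
  qed
  define f where "f k x = (INF y. h k y + real k * dist x y)" for k x
  have bdd: "bdd_below (range (\<lambda>y. h k y + real k * dist x y))" for k x
    using h0 by (intro bdd_belowI[of _ 0]) auto
  have le: "f k x \<le> h k y + real k * dist x y" for k x y
    unfolding f_def by (intro cINF_lower bdd) simp
  have f0: "0 \<le> f k x" for k x
    unfolding f_def using h0 by (intro cINF_greatest) auto
  have lip: "f k x \<le> f k z + real k * dist x z" for k x z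
  proof -
    have "f k x - real k * dist x z \<le> f k z"
      unfolding f_def[of k z]
    proof (rule cINF_greatest)
      fix y
      have "real k * dist x y \<le> real k * (dist x z + dist z y)"
        by (intro mult_left_mono dist_triangle) simp
      then show "f k x - real k * dist x z \<le> h k y + real k * dist z y"
        using le[of k x y] by (simp add: algebra_simps)
    qed simp
    then show ?thesis by simp
  qed
  have "continuous_on UNIV (f k)" for k
  proof (rule lipschitz_on_continuous_on[of "real k"], rule lipschitz_onI)
    show "dist (f k x) (f k y) \<le> real k * dist x y" for x y
      using lip[of k x y] lip[of k y x] by (simp add: dist_real_def dist_commute abs_le_iff)
  qed simp
  moreover have "f k x \<le> real k" for k x using le[of k x x] hk[of k x] by simp
  moreover have "f k x \<le> f (Suc k) x" for k x
    unfolding f_def[of "Suc k"]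
  proof (rule cINF_greatest)
    fix y
    have "real k * dist x y \<le> real (Suc k) * dist x y" by (intro mult_right_mono) auto
    then show "f k x \<le> h (Suc k) y + real (Suc k) * dist x y"
      using le[of k x y] hmono[of k y] by linarith
  qed simp
  moreover have "(SUP k. ennreal (f k x)) = I x" for x
  proof (rule antisym)
    show "(SUP k. ennreal (f k x)) \<le> I x"
    proof (rule SUP_least)
      fix k
      have "ennreal (f k x) \<le> ennreal (h k x)" using le[of k x x] by (intro ennreal_leI) simp
      also have "\<dots> \<le> I x" by (simp add: h)
      finally show "ennreal (f k x) \<le> I x" .
    qed
    show "I x \<le> (SUP k. ennreal (f k x))"
    proof (rule dense_le)
      fix u assume u: "u < I x"
      then have "u < \<infinity>" by (auto simp: less_top[symmetric])
      then obtain r where r: "u = ennreal r" "r \<ge> 0" by (cases u) auto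
      have "open {y. u < I y}" using I by (simp add: lower_semicontinuous_def)
      then obtain \<delta> where \<delta>: "\<delta> > 0" "\<And>y. dist x y < \<delta> \<Longrightarrow> u < I y"
        using u by (auto simp: open_contains_ball subset_iff)
      obtain k :: nat where k: "real k \<ge> max r (r / \<delta>)" using real_arch_simple by blast
      have "r \<le> f k x" unfolding f_def
      proof (rule cINF_greatest)
        fix y
        show "r \<le> h k y + real k * dist x y"
        proof (cases "dist x y < \<delta>")
          case True
          have "ennreal r \<le> of_nat k" using k by (simp add: ennreal_of_nat_eq_real_of_nat)
          then have "ennreal r \<le> ennreal (h k y)" using \<delta>(2)[OF True] r by (simp add: h)
          then have "r \<le> h k y" using h0 by (simp add: ennreal_le_iff)
          then show ?thesis by (simp add: add_increasing2)
        next
          case False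
          have "r \<le> real k * \<delta>" using k \<delta>(1) by (simp add: pos_divide_le_eq)
          also have "\<dots> \<le> real k * dist x y" using False by (intro mult_left_mono) auto
          finally show ?thesis using h0[of k y] by linarith
        qed
      qed simp
      then have "u \<le> ennreal (f k x)" unfolding r(1) by (rule ennreal_leI)
      also have "\<dots> \<le> (SUP k. ennreal (f k x))" by (rule SUP_upper) simp
      finally show "u \<le> (SUP k. ennreal (f k x))" .
    qed
  qed
  ultimately show thesis using that f0 by blast
qed

section \<open>Lower bounds for the entropy\<close>

lemma Urysohn_function:
  fixes K U :: "'a::metric_space set"
  assumes "closed K" "open U" "K \<subseteq> U"
  obtains g :: "'a \<Rightarrow> real" where "continuous_on UNIV g" "\<And>x. 0 \<le> g x" "\<And>x. g x \<le> 1"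
    "\<And>x. x \<in> K \<Longrightarrow> g x = 1" "\<And>x. x \<notin> U \<Longrightarrow> g x = 0"
proof -
  have "normal_space (euclidean :: 'a topology)"
    by (rule metrizable_imp_normal_space[OF metrizable_space_euclidean])
  then obtain g where g: "continuous_map euclidean (top_of_set {0..1::real}) g"
    "g ` (- U) \<subseteq> {0}" "g ` K \<subseteq> {1}"
    by (rule Urysohn_lemma[of euclidean "- U" K 0 1]) (use assms in \<open>auto simp: disjnt_def\<close>)
  show thesis
  proof (rule that[of g])
    show "continuous_on UNIV g" using g(1) by (simp add: continuous_map_in_subtopology)
    show "0 \<le> g x" "g x \<le> 1" for x
      using g(1) by (auto simp: continuous_map_in_subtopology image_subset_iff)
  qed (use g in auto)
qed

lemma borel_prob_large_compact:
  fixes \<nu> :: "'a::polish_space measure"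
  assumes \<nu>: "\<nu> \<in> borel_probs" and "\<delta> > 0"
  obtains K where "compact K" "measure \<nu> (- K) < \<delta>"
proof -
  interpret prob_space \<nu> by (rule borel_probsD(1)[OF \<nu>])
  have "ennreal (1 - \<delta>) < emeasure \<nu> UNIV"
    using emeasure_space_1 borel_probsD(3)[OF \<nu>] \<open>\<delta> > 0\<close>
    by (simp add: ennreal_less_one_iff)
  also have "emeasure \<nu> UNIV = (SUP K\<in>{K. K \<subseteq> UNIV \<and> compact K}. emeasure \<nu> K)"
    by (intro inner_regular borel_probsD(2)[OF \<nu>]) auto
  finally obtain K where K: "compact K" "ennreal (1 - \<delta>) < emeasure \<nu> K"
    by (auto simp: less_SUP_iff)
  have "K \<in> sets \<nu>" using K(1) borel_probsD(2)[OF \<nu>] by (simp add: compact_imp_closed)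
  then have "measure \<nu> (- K) = 1 - measure \<nu> K"
    using prob_compl[of K] borel_probsD(3)[OF \<nu>] by (simp add: Compl_eq_Diff_UNIV)
  moreover have "1 - \<delta> < measure \<nu> K"
    using K(2) unfolding emeasure_eq_measure by (metis ennreal_leI not_le)
  ultimately show thesis using that K(1) by simp
qed

text \<open>The test function is \<open>\<psi> = f g\<close>, where \<open>g\<close> is a continuous cutoff that is 1 on a compact set \<open>K\<close> and
  0 outside the neighbourhood \<open>U\<close> of \<open>K\<close> from the Laplace bound for \<open>\<phi> = - f\<close>. As \<open>f \<le> I\<close>, that
  bound makes the integral of \<open>exp (a\<^sub>n f)\<close> over \<open>U\<close> grow at a small exponential rate, and off \<open>U\<close> the integrand
  \<open>exp (a\<^sub>n \<psi>)\<close> is 1. Continuity of \<open>\<psi>\<close> allows the passage to the limit \<open>\<nu>\<close>, and the choice of \<open>K\<close> makes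
  the loss from the cutoff small.\<close>

lemma local_decay_imp_liminf_entropy_ge_integral:
  fixes \<mu> :: "nat \<Rightarrow> 'a::polish_space measure"
  assumes a: "\<And>n. a n > 0" "filterlim a at_top sequentially" and \<mu>: "\<And>n. \<mu> n \<in> borel_probs"
    and loc: "local_decay \<mu> a I" and lim: "limitin narrow_topology s \<nu> sequentially"
    and f: "continuous_on UNIV f" "\<And>x. 0 \<le> f x" "\<And>x. f x \<le> M" "\<And>x. ennreal (f x) \<le> I x"
  shows "ereal (\<integral>x. f x \<partial>\<nu>) \<le> liminf (\<lambda>n. scaled_entropy \<mu> a n (s n))"
proof (rule ereal_le_epsilon2)
  fix \<eta> :: real assume "\<eta> > 0"
  have \<nu>: "\<nu> \<in> borel_probs" using limitin_topspace[OF lim] by (simp add: topspace_narrow_topology)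
  interpret prob_space \<nu> by (rule borel_probsD(1)[OF \<nu>])
  have M: "0 \<le> M" using f(2,3) order_trans by blast
  \<comment> \<open>\<open>M + 1\<close> instead of \<open>M\<close> because \<open>M\<close> may be 0;
    the loss \<open>\<eta>\<close> is spent as \<open>\<eta>/2\<close> on the cutoff,
    \<open>\<eta>/4\<close> on the convergence to \<open>\<nu>\<close> and \<open>\<eta>/4\<close> on the exponential integral\<close>
  define \<delta> where "\<delta> = \<eta> / (2 * (M + 1))"
  have "\<delta> > 0" using \<open>\<eta> > 0\<close> M by (simp add: \<delta>_def)
  then obtain K where K: "compact K" "measure \<nu> (- K) < \<delta>"
    using borel_prob_large_compact[OF \<nu>] by blast
  let ?\<phi> = "\<lambda>(n::nat) x. ereal (- f x)"
  have fm [measurable]: "f \<in> borel_measurable borel" using f(1) by (rule borel_measurable_continuous_onI)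
  have "measurable_bounded_below ?\<phi>"
  proof -
    have "ereal (- M) \<le> (INF n. INF x. ?\<phi> n x)" using f(3) by (intro INF_greatest) auto
    then have "- \<infinity> < (INF n. INF x. ?\<phi> n x)" by (rule less_le_trans[rotated]) simp
    then show ?thesis unfolding measurable_bounded_below_def by simp
  qed
  moreover have "(SUP x. if I x = \<infinity> then -\<infinity> else - Gamma_liminf euclidean ?\<phi> x - enn2ereal (I x))
      < ereal (\<eta> / 8)"
  proof -
    have "(if I x = \<infinity> then -\<infinity> else - Gamma_liminf euclidean ?\<phi> x - enn2ereal (I x)) \<le> 0" for x
    proof (cases "I x = \<infinity>")
      case False
      then obtain i where i: "I x = ennreal i" "i \<ge> 0" by (cases "I x") auto
      have "ereal (- f x) \<le> Gamma_liminf euclidean ?\<phi> x"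
      proof (rule Gamma_liminf_geI)
        fix z assume "limitin euclidean z x sequentially"
        then have "(\<lambda>n. f (z n)) \<longlonglongrightarrow> f x"
          using f(1) by (auto intro: continuous_on_tendsto_compose)
        then have "(\<lambda>n. ereal (- f (z n))) \<longlonglongrightarrow> ereal (- f x)" by (intro tendsto_intros)
        then show "ereal (- f x) \<le> liminf (\<lambda>n. ereal (- f (z n)))"
          by (intro order_eq_refl lim_imp_Liminf[symmetric]) auto
      qed
      then have "- Gamma_liminf euclidean ?\<phi> x - enn2ereal (I x) \<le> - ereal (- f x) - enn2ereal (I x)"
        by (intro ereal_minus_mono) (simp_all only: ereal_minus_le_minus order_refl)
      also have "\<dots> \<le> 0" using f(4)[of x] i by (simp add: enn2ereal_ennreal)
      finally show ?thesis using False by simp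
    qed simp
    then have "(SUP x. if I x = \<infinity> then -\<infinity> else - Gamma_liminf euclidean ?\<phi> x - enn2ereal (I x)) \<le> 0"
      by (intro SUP_least)
    also have "0 < ereal (\<eta> / 8)" using \<open>\<eta> > 0\<close> by simp
    finally show ?thesis .
  qed
  ultimately obtain U where U: "open U" "K \<subseteq> U" "\<forall>\<^sub>F n in sequentially.
      (\<integral>\<^sup>+x\<in>U. exp_ereal (- (ereal (a n) * ?\<phi> n x)) \<partial>\<mu> n) \<le> ennreal (exp (a n * (\<eta> / 8)))"
    using local_decay_laplace_near_compact[OF a \<mu> loc _ K(1)] by blast
  obtain g where g: "continuous_on UNIV g" "\<And>x. 0 \<le> g x" "\<And>x. g x \<le> 1"
    "\<And>x. x \<in> K \<Longrightarrow> g x = 1" "\<And>x. x \<notin> U \<Longrightarrow> g x = (0::real)"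
    using Urysohn_function[OF compact_imp_closed[OF K(1)] U(1,2)] by blast
  define \<psi> where "\<psi> x = f x * g x" for x
  have \<psi>: "0 \<le> \<psi> x" "\<psi> x \<le> f x" "\<psi> x \<le> M" for x
    using mult_left_le[OF g(3) f(2), of x x] f(2,3)[of x] g(2)[of x] by (auto simp: \<psi>_def)
  have \<psi>_cont: "continuous_on UNIV \<psi>" unfolding \<psi>_def by (intro continuous_intros f g)
  then have \<psi>m [measurable]: "\<psi> \<in> borel_measurable borel" by (rule borel_measurable_continuous_onI)
  have \<psi>_bd: "\<bar>\<psi> x\<bar> \<le> M" for x using \<psi>[of x] by simp
  then have "bounded (range \<psi>)" by (auto simp: bounded_iff)
  from limitin_narrow_imp_tendsto_integral[OF lim \<psi>_cont this]
  have "\<forall>\<^sub>F n in sequentially. (\<integral>x. \<psi> x \<partial>\<nu>) - \<eta> / 4 < (\<integral>x. \<psi> x \<partial>s n)"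
    by (rule order_tendstoD) (use \<open>\<eta> > 0\<close> in simp)
  moreover have "(\<integral>x. f x \<partial>\<nu>) - \<eta> / 2 \<le> (\<integral>x. \<psi> x \<partial>\<nu>)"
  proof -
    have int: "integrable \<nu> f" "integrable \<nu> \<psi>"
      using f(2,3) by (auto intro!: bounded_imp_integrable_borel_prob[OF \<nu>, of _ M] \<psi>_bd)
    have Km: "- K \<in> sets \<nu>" using K(1) borel_probsD(2)[OF \<nu>] by (simp add: compact_imp_closed)
    have "(\<integral>x. f x \<partial>\<nu>) - (\<integral>x. \<psi> x \<partial>\<nu>) = (\<integral>x. f x - \<psi> x \<partial>\<nu>)" using int by simp
    also have "\<dots> \<le> (\<integral>x. M * indicator (- K) x \<partial>\<nu>)"
    proof (rule integral_mono)
      show "integrable \<nu> (\<lambda>x. f x - \<psi> x)" using int by simp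
      show "integrable \<nu> (\<lambda>x. M * indicator (- K) x)"
        using Km by (intro integrable_mult_right integrable_real_indicator) (auto simp: emeasure_eq_measure)
      show "f x - \<psi> x \<le> M * indicator (- K) x" for x
        using g(4)[of x] \<psi>(1)[of x] f(3)[of x] by (cases "x \<in> K") (auto simp: \<psi>_def)
    qed
    also have "\<dots> = M * measure \<nu> (- K)" using Km by simp
    also have "\<dots> \<le> (M + 1) * \<delta>" using K(2) M by (intro mult_mono) auto
    also have "\<dots> = \<eta> / 2" unfolding \<delta>_def using M by (simp add: divide_eq_eq algebra_simps)
    finally show ?thesis by simp
  qed
  ultimately have ev: "\<forall>\<^sub>F n in sequentially. (\<integral>x. f x \<partial>\<nu>) - \<eta> \<le> (\<integral>x. \<psi> x \<partial>s n) - \<eta> / 4"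
    by (auto elim!: eventually_mono)
  have "\<eta> / 8 < \<eta> / 4" using \<open>\<eta> > 0\<close> by simp
  from ev U(3) eventually_mult_exp_le[OF a(2) this, of 2]
  have "\<forall>\<^sub>F n in sequentially. ereal ((\<integral>x. f x \<partial>\<nu>) - \<eta>) \<le> scaled_entropy \<mu> a n (s n)"
  proof eventually_elim
    case (elim n)
    interpret \<mu>: prob_space "\<mu> n" by (rule borel_probsD(1)[OF \<mu>])
    note [measurable_cong] = borel_probsD(2)[OF \<mu>, of n]
    have [measurable]: "U \<in> sets borel" using U(1) by simp
    have "(\<integral>\<^sup>+x. ennreal (exp (a n * \<psi> x)) \<partial>\<mu> n)
        \<le> (\<integral>\<^sup>+x. 1 + ennreal (exp (a n * f x)) * indicator U x \<partial>\<mu> n)"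
    proof (rule nn_integral_mono)
      fix x
      show "ennreal (exp (a n * \<psi> x)) \<le> 1 + ennreal (exp (a n * f x)) * indicator U x"
      proof (cases "x \<in> U")
        case True
        have "ennreal (exp (a n * \<psi> x)) \<le> ennreal (exp (a n * f x))"
          using \<psi>(2)[of x] a(1)[of n] by (intro ennreal_leI) simp
        with True show ?thesis by (simp add: add_increasing)
      next
        case False
        then show ?thesis using g(5) by (simp add: \<psi>_def)
      qed
    qed
    also have "\<dots> = (\<integral>\<^sup>+x. 1 \<partial>\<mu> n) + (\<integral>\<^sup>+x\<in>U. ennreal (exp (a n * f x)) \<partial>\<mu> n)"
      by (intro nn_integral_add) measurable
    also have "\<dots> \<le> 1 + ennreal (exp (a n * (\<eta> / 8)))"
      using elim(2) by (intro add_mono) (auto simp: \<mu>.emeasure_space_1)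
    also have "\<dots> = ennreal (1 + exp (a n * (\<eta> / 8)))" by simp
    also have "\<dots> \<le> ennreal (exp (a n * (\<eta> / 4)))"
    proof (rule ennreal_leI)
      have "1 \<le> exp (a n * (\<eta> / 8))" using a(1)[of n] \<open>\<eta> > 0\<close> by simp
      with elim(3) show "1 + exp (a n * (\<eta> / 8)) \<le> exp (a n * (\<eta> / 4))" by linarith
    qed
    finally have "ereal ((\<integral>x. \<psi> x \<partial>s n) - \<eta> / 4) \<le> scaled_entropy \<mu> a n (s n)"
      by (intro scaled_entropy_ge_test_function[OF a(1) \<mu> \<psi>m \<psi>_bd])
    with elim(1) show ?case by (meson ereal_less_eq(3) order_trans)
  qed
  then have "ereal ((\<integral>x. f x \<partial>\<nu>) - \<eta>) \<le> liminf (\<lambda>n. scaled_entropy \<mu> a n (s n))"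
    by (rule Liminf_bounded)
  then show "ereal (\<integral>x. f x \<partial>\<nu>) \<le> liminf (\<lambda>n. scaled_entropy \<mu> a n (s n)) + ereal \<eta>"
    by (cases "liminf (\<lambda>n. scaled_entropy \<mu> a n (s n))") auto
qed

text \<open>Monotone convergence along bounded continuous functions increasing to \<open>I\<close>.\<close>

lemma local_decay_imp_Gamma_liminf_entropy:
  fixes \<mu> :: "nat \<Rightarrow> 'a::polish_space measure"
  assumes a: "\<And>n. a n > 0" "filterlim a at_top sequentially" and \<mu>: "\<And>n. \<mu> n \<in> borel_probs"
    and I: "lower_semicontinuous I" and loc: "local_decay \<mu> a I" and \<nu>: "\<nu> \<in> borel_probs"
  shows "enn2ereal (\<integral>\<^sup>+x. I x \<partial>\<nu>) \<le> Gamma_liminf narrow_topology (scaled_entropy \<mu> a) \<nu>"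
proof (rule Gamma_liminf_geI)
  fix s assume lim: "limitin narrow_topology s \<nu> sequentially"
  let ?L = "liminf (\<lambda>n. scaled_entropy \<mu> a n (s n))"
  obtain f where f: "\<And>k. continuous_on UNIV (f k)" "\<And>k x. 0 \<le> f k x" "\<And>k x. f k x \<le> real k"
    "\<And>k x. f k x \<le> f (Suc k) x" "\<And>x. (SUP k. ennreal (f k x)) = I x"
    using lower_semicontinuous_approx[OF I] by blast
  have fI: "ennreal (f k x) \<le> I x" for k x
    unfolding f(5)[symmetric] by (rule SUP_upper) simp
  note fm = borel_measurable_continuous_onI[OF f(1)]
  have le: "ereal (\<integral>x. f k x \<partial>\<nu>) \<le> ?L" for k
    by (rule local_decay_imp_liminf_entropy_ge_integral[OF a \<mu> loc lim f(1,2,3) fI])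
  have int: "integrable \<nu> (f k)" for k
    using f(2,3) by (intro bounded_imp_integrable_borel_prob[OF \<nu> fm, of _ "real k"]) auto
  have "0 \<le> ereal (\<integral>x. f 0 x \<partial>\<nu>)" using f(2) by simp
  then have L0: "0 \<le> ?L" using le by (rule order_trans)
  have "(\<integral>\<^sup>+x. I x \<partial>\<nu>) = (\<integral>\<^sup>+x. (SUP k. ennreal (f k x)) \<partial>\<nu>)" by (simp add: f(5))
  also have "\<dots> = (SUP k. \<integral>\<^sup>+x. ennreal (f k x) \<partial>\<nu>)"
  proof (rule nn_integral_monotone_convergence_SUP)
    show "incseq (\<lambda>k x. ennreal (f k x))"
      using f(4) by (intro incseq_SucI le_funI ennreal_leI) auto
    show "(\<lambda>x. ennreal (f k x)) \<in> borel_measurable \<nu>" for k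
      using int[of k] by (auto dest: borel_measurable_integrable)
  qed
  also have "\<dots> \<le> e2ennreal ?L"
  proof (rule SUP_least)
    fix k
    have "(\<integral>\<^sup>+x. ennreal (f k x) \<partial>\<nu>) = e2ennreal (ereal (\<integral>x. f k x \<partial>\<nu>))"
      using nn_integral_eq_integral[OF int] f(2) by simp
    also have "\<dots> \<le> e2ennreal ?L" using le by (rule e2ennreal_mono)
    finally show "(\<integral>\<^sup>+x. ennreal (f k x) \<partial>\<nu>) \<le> e2ennreal ?L" .
  qed
  finally have "enn2ereal (\<integral>\<^sup>+x. I x \<partial>\<nu>) \<le> enn2ereal (e2ennreal ?L)"
    by (simp only: less_eq_ennreal.rep_eq)
  then show "enn2ereal (\<integral>\<^sup>+x. I x \<partial>\<nu>) \<le> ?L" by (simp only: enn2ereal_e2ennreal[OF L0])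
qed

text \<open>The \<open>\<Gamma>\<close>-lower limit at the Dirac mass bounds the entropy of all measures carried by some ball
  around \<open>x\<close> from below. One of them is \<open>\<mu> n\<close> conditioned on the ball, whose entropy is at most minus the
  logarithm of the mass of the ball.\<close>

lemma Gamma_liminf_entropy_at_Dirac_imp_local_decay:
  fixes \<mu> :: "nat \<Rightarrow> 'a::metric_space measure"
  assumes a: "\<And>n. a n > 0" and \<mu>: "\<And>n. \<mu> n \<in> borel_probs"
    and H1: "\<And>x. enn2ereal (I x) \<le> Gamma_liminf narrow_topology (scaled_entropy \<mu> a) (return borel x)"
  shows "local_decay \<mu> a I"
  unfolding local_decay_def
proof (intro allI impI)
  fix x t assume "ereal t < enn2ereal (I x)"
  then have t: "ereal t < Gamma_liminf narrow_topology (scaled_entropy \<mu> a) (return borel x)"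
    using H1 by (rule less_le_trans)
  define B where "B k = ball x (inverse (real (Suc k)))" for k
  define V where "V k = {\<nu> \<in> borel_probs. emeasure \<nu> (B k) = 1}" for k
  have B_meas: "B k \<in> sets borel" for k by (simp add: B_def)
  have B_sub: "B (Suc k) \<subseteq> B k" for k unfolding B_def by (intro subset_ball) (simp add: field_simps)
  have dec: "decseq V"
  proof (rule decseq_SucI, rule subsetI)
    fix k \<nu> assume "\<nu> \<in> V (Suc k)"
    then have \<nu>: "\<nu> \<in> borel_probs" "emeasure \<nu> (B (Suc k)) = 1" by (auto simp: V_def)
    interpret prob_space \<nu> by (rule borel_probsD(1)[OF \<nu>(1)])
    have "emeasure \<nu> (B (Suc k)) \<le> emeasure \<nu> (B k)"
      using B_sub B_meas borel_probsD(2)[OF \<nu>(1)] by (intro emeasure_mono) auto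
    with \<nu>(2) have "emeasure \<nu> (B k) = 1" using emeasure_le_1[of "B k"] by (intro antisym) auto
    with \<nu>(1) show "\<nu> \<in> V k" by (simp add: V_def)
  qed
  have "\<exists>k. \<forall>\<^sub>F n in sequentially. \<forall>\<nu>\<in>V k. ereal t < scaled_entropy \<mu> a n \<nu>"
  proof (rule Gamma_liminf_gt_imp_locally_gt[OF dec _ _ _ t])
    show "V 0 \<subseteq> topspace narrow_topology" by (auto simp: V_def topspace_narrow_topology)
    show "return borel x \<in> V k" for k
      by (simp add: V_def borel_probs_def prob_space_return B_def)
    fix s :: "nat \<Rightarrow> 'a measure"
    assume s: "range s \<subseteq> topspace narrow_topology" "\<And>k. \<forall>\<^sub>F n in sequentially. s n \<in> V k"
    show "limitin narrow_topology s (return borel x) sequentially"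
    proof (rule limitin_narrow_return)
      show "s n \<in> borel_probs" for n using s(1) by (auto simp: topspace_narrow_topology)
      show "\<forall>\<^sub>F n in sequentially. emeasure (s n) (ball x (inverse (real (Suc k)))) = 1" for k
        using s(2)[of k] by eventually_elim (simp add: V_def B_def)
    qed
  qed
  then obtain k where k: "\<forall>\<^sub>F n in sequentially. \<forall>\<nu>\<in>V k. ereal t < scaled_entropy \<mu> a n \<nu>" ..
  then have "\<forall>\<^sub>F n in sequentially. emeasure (\<mu> n) (B k) \<le> ennreal (exp (- (a n * t)))"
  proof eventually_elim
    case (elim n)
    interpret prob_space "\<mu> n" by (rule borel_probsD(1)[OF \<mu>])
    let ?m = "measure (\<mu> n) (B k)"
    show ?case
    proof (rule ccontr)
      assume "\<not> ?thesis"
      then have gt: "exp (- (a n * t)) < ?m" by (simp add: emeasure_eq_measure)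
      then have pos: "0 < ?m" by (rule less_trans[rotated]) simp
      let ?\<nu> = "uniform_measure (\<mu> n) (B k)"
      have em: "emeasure (\<mu> n) (B k) \<noteq> 0" "emeasure (\<mu> n) (B k) \<noteq> \<infinity>"
        using pos by (auto simp: emeasure_eq_measure)
      have "?\<nu> \<in> V k"
        using prob_space_uniform_measure[OF em] emeasure_uniform_measure_1[OF em] borel_probsD(2)[OF \<mu>]
        by (simp add: V_def borel_probs_def)
      then have "ereal t < scaled_entropy \<mu> a n ?\<nu>" using elim by blast
      also have "\<dots> \<le> ereal (1 / a n) * ereal (- ln ?m)"
        unfolding scaled_entropy_def using a[of n]
        by (intro ereal_mult_left_mono rel_entropy_uniform_measure_le \<mu> B_meas pos) auto
      finally have "a n * t < - ln ?m" using a[of n] by (simp add: field_simps)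
      moreover have "- (a n * t) < ln ?m" using gt pos by (metis exp_less_cancel_iff exp_ln)
      ultimately show False by simp
    qed
  qed
  then show "\<exists>U. open U \<and> x \<in> U \<and>
      (\<forall>\<^sub>F n in sequentially. emeasure (\<mu> n) U \<le> ennreal (exp (- (a n * t))))"
    by (intro exI[of _ "B k"]) (auto simp: B_def)
qed

section \<open>The equivalence\<close>

theorem theorem3p5:
  fixes d :: "'a::polish_space \<Rightarrow> 'a \<Rightarrow> real"
    and a :: "nat \<Rightarrow> real"
    and \<mu> :: "nat \<Rightarrow> 'a measure"
    and I :: "'a \<Rightarrow> ennreal"
  assumes "Metric_space UNIV d" and "Metric_space.mtopology UNIV d = euclidean"
    and "\<And>n. a n > 0" and "filterlim a at_top sequentially"
    and "\<And>n. \<mu> n \<in> borel_probs"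
    and "lower_semicontinuous I"
  shows
    "let P1 = ld_weak_upper_bound \<mu> a I;
         P2 = (\<forall>\<phi>. measurable_bounded_below \<phi> \<and> asymptotically_tight_weights \<mu> a \<phi> \<longrightarrow>
                 laplace_upper_bound \<mu> a I \<phi>);
         H1 = (\<forall>x. Gamma_liminf narrow_topology (scaled_entropy \<mu> a) (return borel x)
                 \<ge> enn2ereal (I x));
         H2 = (\<forall>\<nu>\<in>borel_probs. Gamma_liminf narrow_topology (scaled_entropy \<mu> a) \<nu>
                 \<ge> enn2ereal (\<integral>\<^sup>+x. I x \<partial>\<nu>));
         L = (\<forall>K. compact K \<longrightarrow> Gamma_liminf (hausdorff_topology d) (neg_log_mass \<mu> a) K
                 \<ge> (INF x\<in>K. enn2ereal (I x)));
         P3 = ld_upper_bound \<mu> a I;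
         P4 = (\<forall>\<phi>. measurable_bounded_below \<phi> \<longrightarrow> laplace_upper_bound \<mu> a I \<phi>)
     in (P1 \<longleftrightarrow> P2) \<and> (P1 \<longleftrightarrow> H1) \<and> (P1 \<longleftrightarrow> H2) \<and> (P1 \<longleftrightarrow> L) \<and>
        (exponentially_tight \<mu> a \<longrightarrow> (P1 \<longleftrightarrow> P3) \<and> (P1 \<longleftrightarrow> P4))"
proof -
  note d = assms(1,2) and a = assms(3,4) and \<mu> = assms(5) and I = assms(6)
  define P1 where "P1 = ld_weak_upper_bound \<mu> a I"
  define P2 where "P2 = (\<forall>\<phi>. measurable_bounded_below \<phi> \<and> asymptotically_tight_weights \<mu> a \<phi> \<longrightarrow>
    laplace_upper_bound \<mu> a I \<phi>)"
  define H1 where "H1 = (\<forall>x. Gamma_liminf narrow_topology (scaled_entropy \<mu> a) (return borel x)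
    \<ge> enn2ereal (I x))"
  define H2 where "H2 = (\<forall>\<nu>\<in>borel_probs. Gamma_liminf narrow_topology (scaled_entropy \<mu> a) \<nu>
    \<ge> enn2ereal (\<integral>\<^sup>+x. I x \<partial>\<nu>))"
  define L where "L = (\<forall>K. compact K \<longrightarrow> Gamma_liminf (hausdorff_topology d) (neg_log_mass \<mu> a) K
    \<ge> (INF x\<in>K. enn2ereal (I x)))"
  define P3 where "P3 = ld_upper_bound \<mu> a I"
  define P4 where "P4 = (\<forall>\<phi>. measurable_bounded_below \<phi> \<longrightarrow> laplace_upper_bound \<mu> a I \<phi>)"
  define D where "D = local_decay \<mu> a I"
  have "D" if "P1"
    using ld_weak_upper_bound_imp_local_decay[OF a(1) \<mu> I] that by (simp add: P1_def D_def)
  moreover have "P2" if "D"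
    using local_decay_imp_laplace_upper_bound_tight_weights[OF a \<mu>] that by (simp add: P2_def D_def)
  moreover have "P1" if "P2"
    unfolding P1_def ld_weak_upper_bound_def
  proof (intro allI impI)
    fix K :: "'a set" assume K: "compact K"
    then have "laplace_upper_bound \<mu> a I (\<lambda>_. barrier K)"
      using that asymptotically_tight_weights_barrier[OF a(1) K]
        measurable_bounded_below_barrier[OF compact_imp_closed[OF K]] by (simp add: P2_def)
    then show "limsup (\<lambda>n. ereal (1 / a n) * ln_ennreal (emeasure (\<mu> n) K))
        \<le> - (INF x\<in>K. enn2ereal (I x))"
      by (rule laplace_upper_bound_barrier_imp[OF a(1) \<mu> compact_imp_closed[OF K]])
  qed
  moreover have "H2" if "D"
    using local_decay_imp_Gamma_liminf_entropy[OF a \<mu> I] that by (simp add: H2_def D_def)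
  moreover have "H1" if "H2"
    unfolding H1_def
  proof
    fix x :: 'a
    have "return borel x \<in> borel_probs" by (simp add: borel_probs_def prob_space_return)
    moreover have "I \<in> borel_measurable borel"
      using I by (intro borel_measurableI_greater) (simp add: lower_semicontinuous_def)
    then have "(\<integral>\<^sup>+y. I y \<partial>return borel x) = I x" by (simp add: nn_integral_return)
    ultimately show "Gamma_liminf narrow_topology (scaled_entropy \<mu> a) (return borel x)
        \<ge> enn2ereal (I x)"
      using that unfolding H2_def by metis
  qed
  moreover have "D" if "H1"
    using Gamma_liminf_entropy_at_Dirac_imp_local_decay[OF a(1) \<mu>] that by (simp add: H1_def D_def)
  moreover have "L" if "D"
    using local_decay_imp_Gamma_liminf_neg_log_mass[OF d a \<mu>] that by (simp add: L_def D_def)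
  moreover have "P1" if "L"
    unfolding P1_def
    using that unfolding L_def
    by (intro Gamma_liminf_neg_log_mass_imp_ld_weak_upper_bound[where d = d]) blast
  moreover have "P4" if "D" "exponentially_tight \<mu> a"
    using local_decay_imp_laplace_upper_bound_exponentially_tight[OF a \<mu>] that
    by (simp add: P4_def D_def)
  moreover have "P3" if "P4"
    unfolding P3_def ld_upper_bound_def
  proof (intro allI impI)
    fix C :: "'a set" assume C: "closed C"
    then have "laplace_upper_bound \<mu> a I (\<lambda>_. barrier C)"
      using that measurable_bounded_below_barrier[OF C] by (simp add: P4_def)
    then show "limsup (\<lambda>n. ereal (1 / a n) * ln_ennreal (emeasure (\<mu> n) C))
        \<le> - (INF x\<in>C. enn2ereal (I x))"
      by (rule laplace_upper_bound_barrier_imp[OF a(1) \<mu> C])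
  qed
  moreover have "P1" if "P3"
    using that by (simp add: P1_def P3_def ld_weak_upper_bound_def ld_upper_bound_def compact_imp_closed)
  ultimately have "(P1 \<longleftrightarrow> P2) \<and> (P1 \<longleftrightarrow> H1) \<and> (P1 \<longleftrightarrow> H2) \<and> (P1 \<longleftrightarrow> L) \<and>
      (exponentially_tight \<mu> a \<longrightarrow> (P1 \<longleftrightarrow> P3) \<and> (P1 \<longleftrightarrow> P4))"
    by blast
  then show ?thesis
    unfolding P1_def P2_def H1_def H2_def L_def P3_def P4_def Let_def .
qed

end
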